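(* Let $p \ge 2$, $\epsilon > 0$, $\mathbf{A} \in \mathbb{R}^{m \times n}$, $\mathbf{b} \in \mathbb{R}^m$, and let $\mathbf{C},\mathbf{d}$ be a (possibly empty) matrix and vector with $\{\mathbf{x} : \mathbf{C}\mathbf{x} = \mathbf{d}\}$ nonempty. Let $\mathbf{x}^{\star} = \arg\min_{\mathbf{x} : \mathbf{C}\mathbf{x} = \mathbf{d}} \|\mathbf{A}\mathbf{x} - \mathbf{b}\|_p^p$. Then the algorithm $p$-IRLS described in the context, run on input $(\mathbf{A},\mathbf{b},\epsilon,\mathbf{C},\mathbf{d})$, returns $\mathbf{x}$ such that $\|\mathbf{A}\mathbf{x} - \mathbf{b}\|_p^p \le (1+\epsilon)\|\mathbf{A}\mathbf{x}^{\star} - \mathbf{b}\|_p^p$ and $\mathbf{C}\mathbf{x} = \mathbf{d}$, in at most $O\!\left(p^{3.5} m^{\frac{p-2}{2(p-1)}} \log\frac{m}{\epsilon}\right)$ iterations (of its while loop).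
   Context: Notation: for a vector $\mathbf{v}$, $|\mathbf{v}|^{q}$ is taken entrywise; $\mathrm{diag}(\mathbf{v})$ is the diagonal matrix with diagonal $\mathbf{v}$; $\mathbf{I}$ is the $m\times m$ identity. For a current point $\mathbf{x}$, let $\mathbf{R} = \mathrm{diag}(|\mathbf{A}\mathbf{x}-\mathbf{b}|^{p-2})$ and $\mathbf{g} = p\mathbf{R}(\mathbf{A}\mathbf{x}-\mathbf{b}) \in \mathbb{R}^m$, and define the residual objective at $\mathbf{x}$ by $\mathrm{res}(\Delta) = \mathbf{g}^{\top}\mathbf{A}\Delta - 2p^2 \Delta^{\top}\mathbf{A}^{\top}\mathbf{R}\mathbf{A}\Delta - p^p\|\mathbf{A}\Delta\|_p^p$ for $\Delta \in \mathbb{R}^n$. Algorithm $p$-IRLS$(\mathbf{A},\mathbf{b},\epsilon,\mathbf{C},\mathbf{d})$: 1. $\mathbf{x} \leftarrow \arg\min_{\mathbf{C}\mathbf{x}=\mathbf{d}} \|\mathbf{A}\mathbf{x}-\mathbf{b}\|_2^2$; $i \leftarrow \|\mathbf{A}\mathbf{x}-\mathbf{b}\|_p^p/(16p)$. 2. While $\frac{\epsilon}{16p(1+\epsilon)}\|\mathbf{A}\mathbf{x}-\mathbf{b}\|_p^p < i$: (a) $\mathbf{R} \leftarrow \mathrm{diag}(|\mathbf{A}\mathbf{x}-\mathbf{b}|^{p-2})$, $\mathbf{g} \leftarrow p\mathbf{R}(\mathbf{A}\mathbf{x}-\mathbf{b})$, $s \leftarrow \frac12 i^{(p-2)/p} m^{-(p-2)/p}$;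 (b) $\tilde\Delta \leftarrow \arg\min \{\Delta^{\top}\mathbf{A}^{\top}(\mathbf{R}+s\mathbf{I})\mathbf{A}\Delta : \mathbf{g}^{\top}\mathbf{A}\Delta = i/2,\ \mathbf{C}\Delta = 0\}$; (c) $\alpha \leftarrow \arg\min_{\alpha \in \mathbb{R}} \|\mathbf{A}(\mathbf{x} - \alpha\tilde\Delta) - \mathbf{b}\|_p^p$ (line search), and the next iterate is $\mathbf{x} - \alpha\tilde\Delta$; (d) with $\lambda = 16p$, $k = \frac{p^p\|\mathbf{A}\tilde\Delta\|_p^p}{2p^2\tilde\Delta^{\top}\mathbf{A}^{\top}(\mathbf{R}+s\mathbf{I})\mathbf{A}\tilde\Delta}$, $\alpha_0 = \min\{\frac{1}{16\lambda}, \frac{1}{(16\lambda k)^{1/(p-1)}}\}$, if $\mathrm{res}(\alpha_0\tilde\Delta) < \frac{\alpha_0}{4} i$ (residual objective with respect to the point used in (a)) or $\tilde\Delta^{\top}\mathbf{A}^{\top}(\mathbf{R}+s\mathbf{I})\mathbf{A}\tilde\Delta > \lambda i/p^2$, then $i \leftarrow i/2$. 3. Return $\mathbf{x}$.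
   Formalization: The factor log(m/ε) is read as max(1, ln(m/min(1,ε))), since the literal bound is nonpositive for ε ≥ m although an iteration may be needed; and if the problem in step (b) has no feasible Δ (x already optimal), the iteration keeps x and halves i. *)

theory Defs
  imports Complex_Main "Jordan_Normal_Form.Matrix"
begin

(* Matrices and vectors carry their dimensions as natural numbers, so that one constant in the
   iteration bound can serve all dimensions, and so that the constraint matrix C may have no rows. *)

definition pnorm :: "real \<Rightarrow> real vec \<Rightarrow> real" where
  "pnorm p v = (\<Sum>i<dim_vec v. \<bar>v $ i\<bar> powr p) powr (1 / p)"

(* The case distinction gives |0|^0 = 1 (needed for p = 2, where the weights are |r|^0);
   the library has 0 powr 0 = 0. *)
definition abs_powr_vec :: "real vec \<Rightarrow> real \<Rightarrow> real vec" where
  "abs_powr_vec v q = map_vec (\<lambda>t. if q = 0 then 1 else \<bar>t\<bar> powr q) v"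

definition diag_of_vec :: "real vec \<Rightarrow> real mat" where
  "diag_of_vec v = mat_diag (dim_vec v) (\<lambda>i. v $ i)"

definition feasible :: "nat \<Rightarrow> real mat \<Rightarrow> real vec \<Rightarrow> real vec \<Rightarrow> bool" where
  "feasible n C d x \<longleftrightarrow> x \<in> carrier_vec n \<and> C *\<^sub>v x = d"

definition objective :: "real \<Rightarrow> real mat \<Rightarrow> real vec \<Rightarrow> real vec \<Rightarrow> real" where
  "objective p A b x = pnorm p (A *\<^sub>v x - b) powr p"

definition weights :: "real \<Rightarrow> real mat \<Rightarrow> real vec \<Rightarrow> real vec \<Rightarrow> real mat" where
  "weights p A b x = diag_of_vec (abs_powr_vec (A *\<^sub>v x - b) (p - 2))"

definition gradient :: "real \<Rightarrow> real mat \<Rightarrow> real vec \<Rightarrow> real vec \<Rightarrow> real vec" where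
  "gradient p A b x = p \<cdot>\<^sub>v (weights p A b x *\<^sub>v (A *\<^sub>v x - b))"

definition residual :: "real \<Rightarrow> real mat \<Rightarrow> real vec \<Rightarrow> real vec \<Rightarrow> real vec \<Rightarrow> real" where
  "residual p A b x \<Delta> =
     gradient p A b x \<bullet> (A *\<^sub>v \<Delta>)
     - 2 * p\<^sup>2 * (\<Delta> \<bullet> ((A\<^sup>T * weights p A b x * A) *\<^sub>v \<Delta>))
     - p powr p * pnorm p (A *\<^sub>v \<Delta>) powr p"

definition padding :: "real \<Rightarrow> nat \<Rightarrow> real \<Rightarrow> real" where
  "padding p m i = 1 / 2 * i powr ((p - 2) / p) * real m powr (- ((p - 2) / p))"

definition padded_energy ::
    "real \<Rightarrow> real mat \<Rightarrow> real vec \<Rightarrow> real vec \<Rightarrow> real \<Rightarrow> real vec \<Rightarrow> real" where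
  "padded_energy p A b x i \<Delta> =
     \<Delta> \<bullet> ((A\<^sup>T * (weights p A b x + padding p (dim_row A) i \<cdot>\<^sub>m 1\<^sub>m (dim_row A)) * A) *\<^sub>v \<Delta>)"

definition direction_feasible ::
    "real \<Rightarrow> real mat \<Rightarrow> real vec \<Rightarrow> real mat \<Rightarrow> real vec \<Rightarrow> real \<Rightarrow> real vec \<Rightarrow> bool" where
  "direction_feasible p A b C x i \<Delta> \<longleftrightarrow>
     \<Delta> \<in> carrier_vec (dim_col A) \<and>
     gradient p A b x \<bullet> (A *\<^sub>v \<Delta>) = i / 2 \<and>
     C *\<^sub>v \<Delta> = 0\<^sub>v (dim_row C)"

definition halving_test ::
    "real \<Rightarrow> real mat \<Rightarrow> real vec \<Rightarrow> real vec \<Rightarrow> real \<Rightarrow> real vec \<Rightarrow> bool" where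
  "halving_test p A b x i \<Delta> \<longleftrightarrow>
     (let lam = 16 * p;
          energy = padded_energy p A b x i \<Delta>;
          k = p powr p * pnorm p (A *\<^sub>v \<Delta>) powr p / (2 * p\<^sup>2 * energy);
          \<alpha>\<^sub>0 = min (1 / (16 * lam)) (1 / (16 * lam * k) powr (1 / (p - 1)))
      in residual p A b x (\<alpha>\<^sub>0 \<cdot>\<^sub>v \<Delta>) < \<alpha>\<^sub>0 / 4 * i \<or> energy > lam * i / p\<^sup>2)"

(* One pass through the loop body. A minimiser need not be unique, so this is a relation: any
   choice of minimisers is allowed. If the weighted least-squares problem for the direction is
   infeasible (this happens when x is already optimal), its optimal value is infinite: the second
   disjunct of the halving test holds, and there is no direction to move along. *)
inductive irls_step ::
    "real \<Rightarrow> real mat \<Rightarrow> real vec \<Rightarrow> real mat \<Rightarrow>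
     real vec \<Rightarrow> real \<Rightarrow> real vec \<Rightarrow> real \<Rightarrow> bool"
  for p A b C where
  move: "is_arg_min (padded_energy p A b x i) (direction_feasible p A b C x i) \<Delta> \<Longrightarrow>
    is_arg_min (\<lambda>\<alpha>. objective p A b (x - \<alpha> \<cdot>\<^sub>v \<Delta>)) (\<lambda>\<alpha>. True) \<alpha> \<Longrightarrow>
    irls_step p A b C x i (x - \<alpha> \<cdot>\<^sub>v \<Delta>) (if halving_test p A b x i \<Delta> then i / 2 else i)"
| stay: "\<nexists>\<Delta>. direction_feasible p A b C x i \<Delta> \<Longrightarrow>
    irls_step p A b C x i x (i / 2)"

definition loop_guard :: "real \<Rightarrow> real \<Rightarrow> real mat \<Rightarrow> real vec \<Rightarrow> real vec \<Rightarrow> real \<Rightarrow> bool" where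
  "loop_guard p \<epsilon> A b x i \<longleftrightarrow> \<epsilon> / (16 * p * (1 + \<epsilon>)) * objective p A b x < i"

(* irls_run p eps A b C d N x i: after N iterations some run of the algorithm is in state (x, i). *)
inductive irls_run ::
    "real \<Rightarrow> real \<Rightarrow> real mat \<Rightarrow> real vec \<Rightarrow> real mat \<Rightarrow> real vec \<Rightarrow>
     nat \<Rightarrow> real vec \<Rightarrow> real \<Rightarrow> bool"
  for p \<epsilon> A b C d where
  init: "is_arg_min (\<lambda>x. (pnorm 2 (A *\<^sub>v x - b))\<^sup>2) (feasible (dim_col A) C d) x \<Longrightarrow>
    irls_run p \<epsilon> A b C d 0 x (objective p A b x / (16 * p))"
| iterate: "irls_run p \<epsilon> A b C d N x i \<Longrightarrow> loop_guard p \<epsilon> A b x i \<Longrightarrow>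
    irls_step p A b C x i x' i' \<Longrightarrow> irls_run p \<epsilon> A b C d (Suc N) x' i'"

definition irls_returns ::
    "real \<Rightarrow> real \<Rightarrow> real mat \<Rightarrow> real vec \<Rightarrow> real mat \<Rightarrow> real vec \<Rightarrow> real vec \<Rightarrow> bool" where
  "irls_returns p \<epsilon> A b C d x \<longleftrightarrow>
     (\<exists>N i. irls_run p \<epsilon> A b C d N x i \<and> \<not> loop_guard p \<epsilon> A b x i)"

(* p^3.5 m^((p-2)/(2(p-1))) log(m/eps), the logarithm being read as is usual in a complexity bound
   for an accuracy parameter: eps > 1 counts as eps = 1, and the logarithm as at least 1. (Taken
   literally the bound is not positive for eps >= m, but an input with a nonzero initial residual
   always needs an iteration.) *)
definition iteration_bound :: "real \<Rightarrow> nat \<Rightarrow> real \<Rightarrow> real" where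
  "iteration_bound p m \<epsilon> =
     p powr (7 / 2) * real m powr ((p - 2) / (2 * (p - 1))) * max 1 (ln (real m / min 1 \<epsilon>))"

end

(* With r = A x - b, scalar two-sided estimates for |r - v|^p show that the decrease of the objective
   along D is at least res(D) and at most grad(D) - (p/4) D^T A^T R A D - 2^(1-p) |A D|_p^p. The
   lower estimate is Bernoulli's inequality for |r|^p = (r^2)^(p/2), sharpened by Clarkson's
   inequality; it replaces the usual argument with second derivatives.

   Correctness: the gap to the optimum stays at most 16 p i. If it exceeds 8 p i at x, then the
   direction x - y to a better point y, rescaled to grad = i/2, has padded energy at most i/(16 p^2),
   so the minimising direction passes the test and i is not halved.

   Running time: a pass that keeps i decreases the objective by at least i/(1024 p M) with
   M = m^((p-2)/(2(p-1))), so there are O(p^2 M) passes between two halvings; since the least-squares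
   start is within a factor m^((p-2)/2) of optimal, there are O(p log(m/eps)) halvings. *)

theory Submission
  imports Defs
begin

subsection \<open>Scalar inequalities\<close>

text \<open>The padding \<open>s\<close> answers two opposite demands. It must be small, because the
  direction towards a better point has to stay cheap, and by Hoelder its padded part may cost
  \<open>s * m powr ((p - 2) / p) * npow powr (2 / p)\<close>. It must be large, because only the
  bound of \<open>nsq\<close> by energy / s controls the p-th power term of the residual; for an
  energy of at most 16 i / p this gives k <= (32 p m)^((p-2)/2). Since alpha_0 takes a (p-1)-th root
  of k, the exponent of m in the iteration bound is (p-2)/(2(p-1)).

  The p-th power coefficients of the two decrease estimates differ by a factor of about (2 p)^p.
  They are never compared: the upper estimate only shows that a rescaled direction has small energy,
  and k measures the p-th power term relative to that energy. The factor p in the gap bound makes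
  the rescaled direction so short that 2^p is absorbed.

  The theorem also needs that no run gets stuck. A may be rank deficient, so the quadratic problems
  are solved by eliminating coordinates instead of inverting a matrix.\<close>

lemma powr_above_tangent:
  fixes q t c :: real
  assumes "1 \<le> q" "0 \<le> t" "0 \<le> c"
  shows "c powr q + q * c powr (q - 1) * (t - c) \<le> t powr q"
proof -
  \<comment> \<open>By homogeneity the claim is Bernoulli's inequality at z = t / c.\<close>
  have bernoulli: "1 + q * (z - 1) \<le> z powr q" if "0 < z" for z :: real
  proof (cases "0 < 1 + q * (z - 1)")
    case True
    define a where "a = 1 + q * (z - 1)"
    have "a > 0" using True by (simp add: a_def)
    \<comment> \<open>The first bound plus q - 1 times the second has right-hand side exactly 0, by
      the choice of a.\<close>
    have "ln (a / z) \<le> a / z - 1" "ln (1 / z) \<le> 1 / z - 1"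
      using \<open>a > 0\<close> that by (simp_all add: ln_le_minus_one)
    then have l: "ln a - ln z \<le> a / z - 1" "- ln z \<le> 1 / z - 1"
      using \<open>a > 0\<close> that by (simp_all add: ln_div)
    have "(q - 1) * (- ln z) \<le> (q - 1) * (1 / z - 1)"
      using l(2) assms(1) by (intro mult_left_mono) auto
    then have "ln a - q * ln z \<le> (a / z - 1) + (q - 1) * (1 / z - 1)"
      using l(1) by (simp add: algebra_simps)
    also have "\<dots> = 0"
      using that by (simp add: a_def field_simps)
    finally have "exp (ln a) \<le> exp (q * ln z)" by (simp only: exp_le_cancel_iff)
    then have "a \<le> z powr q"
      using \<open>a > 0\<close> that by (simp add: powr_def)
    then show ?thesis by (simp add: a_def)
  next
    case False
    then show ?thesis by (smt (verit) powr_ge_zero)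
  qed
  consider "c = 0" | "t = 0" "c > 0" | "t > 0" "c > 0" using assms by linarith
  then show ?thesis
  proof cases
    case 1
    \<comment> \<open>For q = 1 the slope at c = 0 is also 0, since
      \<open>0 powr 0 = 0\<close>.\<close>
    then show ?thesis using assms by (cases "q = 1") auto
  next
    case 2
    then have "c powr (q - 1) * c = c powr q"
      by (simp add: powr_mult_base powr_diff)
    then have "q * c powr (q - 1) * (t - c) = - (q * c powr q)"
      using 2 by (simp add: mult.assoc)
    moreover have "1 * c powr q \<le> q * c powr q"
      using assms by (intro mult_right_mono) auto
    ultimately have "c powr q + q * c powr (q - 1) * (t - c) \<le> 0" by linarith
    then show ?thesis using powr_ge_zero order_trans by blast
  next
    case 3
    have "c powr q * (1 + q * (t / c - 1)) \<le> c powr q * (t / c) powr q"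
      using 3 bernoulli[of "t / c"] by (intro mult_left_mono) auto
    also have "\<dots> = t powr q" using 3 by (simp add: powr_divide)
    also have "c powr q * (1 + q * (t / c - 1)) = c powr q + q * c powr (q - 1) * (t - c)"
      using 3 by (simp add: powr_diff field_simps)
    finally show ?thesis .
  qed
qed

lemma powr_sq_half: "(x\<^sup>2) powr (p / 2) = \<bar>x\<bar> powr p" for x p :: real
proof -
  have "(x\<^sup>2) powr (p / 2) = (\<bar>x\<bar> powr 2) powr (p / 2)" by simp
  then show ?thesis by (simp only: powr_powr) simp
qed

text \<open>One diagonal entry of R as a function of the residual entry, with the same convention
  |0|^0 = 1.\<close>

definition weight :: "real \<Rightarrow> real \<Rightarrow> real" where
  "weight p t = (if p - 2 = 0 then 1 else \<bar>t\<bar> powr (p - 2))"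

lemma weight_nonneg [simp]: "0 \<le> weight p t"
  by (simp add: weight_def)

lemma weight_mult_sq: "2 \<le> p \<Longrightarrow> weight p r * r\<^sup>2 = \<bar>r\<bar> powr p"
  by (cases "r = 0") (auto simp: weight_def powr_diff)

text \<open>The tangent at r^2 is multiplied by (r + v)^2 - r^2 = 2 r v + v^2, which supplies the
  linear and the quadratic term at once. The case p = 2 is separate because
  \<open>(r\<^sup>2) powr 0\<close> vanishes at r = 0, where the weight is 1.\<close>

lemma powr_weight_lower:
  fixes p r v :: real
  assumes "2 \<le> p"
  shows "\<bar>r\<bar> powr p + p * weight p r * r * v + p / 2 * weight p r * v\<^sup>2 \<le> \<bar>r + v\<bar> powr p"
proof (cases "p = 2")
  case True
  then show ?thesis by (simp add: weight_def power2_eq_square algebra_simps)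
next
  case False
  have "(r\<^sup>2) powr (p/2) + (p/2) * (r\<^sup>2) powr (p/2 - 1) * ((r + v)\<^sup>2 - r\<^sup>2) \<le> ((r + v)\<^sup>2) powr (p/2)"
    using assms by (intro powr_above_tangent) auto
  moreover have "(r\<^sup>2) powr (p/2 - 1) = weight p r"
    using powr_sq_half[of r "p - 2"] False by (simp add: weight_def diff_divide_distrib)
  ultimately have "\<bar>r\<bar> powr p + (p/2) * weight p r * ((r + v)\<^sup>2 - r\<^sup>2) \<le> \<bar>r + v\<bar> powr p"
    by (simp add: powr_sq_half)
  then show ?thesis by (simp add: power2_eq_square algebra_simps)
qed

section \<open>Clarkson's inequality and the upper estimate of a decrease\<close>

lemma powr_superadditive:
  fixes x y q :: real
  assumes "1 \<le> q" "0 \<le> x" "0 \<le> y"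
  shows "x powr q + y powr q \<le> (x + y) powr q"
proof -
  have *: "z powr q = z * z powr (q - 1)" if "z \<ge> 0" for z
    using that by (cases "z = 0") (auto simp: powr_diff)
  have "x * x powr (q - 1) \<le> x * (x + y) powr (q - 1)" "y * y powr (q - 1) \<le> y * (x + y) powr (q - 1)"
    using assms by (auto intro!: mult_left_mono powr_mono2)
  then show ?thesis using *[of x] *[of y] *[of "x + y"] assms by (simp add: algebra_simps)
qed

lemma powr_midpoint:
  fixes x y q :: real
  assumes "1 \<le> q" "0 \<le> x" "0 \<le> y"
  shows "2 * ((x + y) / 2) powr q \<le> x powr q + y powr q"
proof -
  let ?c = "(x + y) / 2"
  have "?c powr q + q * ?c powr (q - 1) * (x - ?c) \<le> x powr q"
       "?c powr q + q * ?c powr (q - 1) * (y - ?c) \<le> y powr q"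
    using assms by (intro powr_above_tangent; simp)+
  moreover have "q * ?c powr (q - 1) * (x - ?c) + q * ?c powr (q - 1) * (y - ?c) = 0"
    by (simp flip: distrib_left)
  ultimately show ?thesis by linarith
qed

text \<open>Superadditivity of z^(p/2) joins the squares of the half sum and the half difference,
  the parallelogram law turns them into the mean of a^2 and b^2, and midpoint convexity separates
  these again.\<close>

lemma clarkson:
  fixes a b p :: real
  assumes "2 \<le> p"
  shows "2 * \<bar>(a + b) / 2\<bar> powr p + 2 * \<bar>(a - b) / 2\<bar> powr p \<le> \<bar>a\<bar> powr p + \<bar>b\<bar> powr p"
proof -
  let ?s = "((a + b) / 2)\<^sup>2" and ?d = "((a - b) / 2)\<^sup>2"
  have "?s powr (p/2) + ?d powr (p/2) \<le> (?s + ?d) powr (p/2)"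
    using assms by (intro powr_superadditive) auto
  moreover have "?s + ?d = (a\<^sup>2 + b\<^sup>2) / 2" by (simp add: power2_eq_square field_simps)
  moreover have "2 * ((a\<^sup>2 + b\<^sup>2) / 2) powr (p/2) \<le> (a\<^sup>2) powr (p/2) + (b\<^sup>2) powr (p/2)"
    using assms by (intro powr_midpoint) auto
  ultimately show ?thesis by (simp only: powr_sq_half)
qed

(* Convexity at the midpoint, sharpened by Clarkson's inequality, adds the p-th power term. *)
lemma powr_decrease_upper:
  fixes p r v :: real
  assumes "2 \<le> p"
  shows "\<bar>r\<bar> powr p - \<bar>r - v\<bar> powr p
    \<le> p * weight p r * r * v - p / 4 * weight p r * v\<^sup>2 - 2 powr (1 - p) * \<bar>v\<bar> powr p"
proof -
  have "2 * \<bar>r - v/2\<bar> powr p + 2 * \<bar>v/2\<bar> powr p \<le> \<bar>r - v\<bar> powr p + \<bar>r\<bar> powr p"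
    using clarkson[OF assms, of "r - v" r] by (simp add: field_simps)
  moreover have "2 * \<bar>v/2\<bar> powr p = 2 powr (1 - p) * \<bar>v\<bar> powr p"
    by (simp add: powr_divide powr_diff)
  moreover have "\<bar>r\<bar> powr p + p * weight p r * r * (- v/2) + p / 2 * weight p r * (- v/2)\<^sup>2 \<le> \<bar>r + (- v/2)\<bar> powr p"
    by (rule powr_weight_lower[OF assms])
  ultimately show ?thesis by (simp add: power2_eq_square algebra_simps)
qed

section \<open>The growth of |1 - d|^p and the lower estimate of a decrease\<close>

lemma exp_le_quadratic:
  fixes y :: real
  assumes "y \<le> 2"
  shows "exp y \<le> 1 + y + 2 * y\<^sup>2"
proof (cases "0 \<le> y")
  case True
  \<comment> \<open>The standard quadratic bound needs an argument in [0, 1], hence y / 2; after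
    squaring, the factor at y^2 is at most 3/2, below the claimed 2.\<close>
  have "exp (y/2) \<le> 1 + y/2 + (y/2)\<^sup>2" using True assms by (intro exp_bound) auto
  then have "exp (y/2) * exp (y/2) \<le> (1 + y/2 + (y/2)\<^sup>2) * (1 + y/2 + (y/2)\<^sup>2)"
    using True by (intro mult_mono) auto
  also have "exp (y/2) * exp (y/2) = exp y" by (simp flip: exp_add)
  also have "(1 + y/2 + (y/2)\<^sup>2) * (1 + y/2 + (y/2)\<^sup>2) = 1 + y + y\<^sup>2 * (3/4 + y/4 + y*y/16)"
    by (simp add: power2_eq_square algebra_simps)
  also have "y\<^sup>2 * (3/4 + y/4 + y*y/16) \<le> y\<^sup>2 * 2"
    using True assms mult_mono[of y 2 y 2] by (intro mult_left_mono) auto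
  finally show ?thesis by simp
next
  case False
  have "1 + (-y) + (-y)\<^sup>2 / 2 \<le> exp (-y)" using False by (intro exp_lower_Taylor_quadratic) auto
  \<comment> \<open>exp (- y) dominates its Taylor polynomial, so it suffices that the product of
    the two polynomials is at least 1.\<close>
  then have "1 \<le> (1 - y + y\<^sup>2/2) * (1 + y + 2*y\<^sup>2)" 
  proof -
    have "(1 - y + y\<^sup>2/2) * (1 + y + 2*y\<^sup>2) = 1 + y\<^sup>2 * (3/2 - 3/2 * y + y\<^sup>2)"
      by (simp add: power2_eq_square algebra_simps)
    then show ?thesis using False by simp
  qed
  also have "\<dots> \<le> exp (-y) * (1 + y + 2*y\<^sup>2)"
  proof (rule mult_right_mono)
    have "1 + y + 2*y\<^sup>2 = 7/8 + 2 * (y + 1/4)\<^sup>2" by (simp add: power2_eq_square algebra_simps)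
    then show "0 \<le> 1 + y + 2*y\<^sup>2" by simp
  qed (use \<open>1 + (-y) + (-y)\<^sup>2 / 2 \<le> exp (-y)\<close> in simp)
  finally show ?thesis by (simp add: exp_minus field_simps)
qed

text \<open>Each range of d has its own dominant term. For d >= 1 the p-th power covers the left
  side and the quadratic term outweighs - p d. For -2/p <= d < 1 the left side is at most exp (- p
  d). For d < -2/p the p-th power again suffices, as 1 - d <= p |d|.\<close>

lemma one_minus_powr_upper:
  fixes p d :: real
  assumes "2 \<le> p"
  shows "\<bar>1 - d\<bar> powr p \<le> 1 - p * d + 2 * p\<^sup>2 * d\<^sup>2 + p powr p * \<bar>d\<bar> powr p"
proof -
  have nn: "0 \<le> p powr p * \<bar>d\<bar> powr p" by simp
  consider "1 \<le> d" | "d < 1" "- p * d \<le> 2" | "- p * d > 2" by linarith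
  then show ?thesis
  proof cases
    case 1
    have "\<bar>1 - d\<bar> powr p \<le> \<bar>d\<bar> powr p" using 1 assms by (intro powr_mono2) auto
    also have "\<dots> \<le> p powr p * \<bar>d\<bar> powr p"
      using mult_right_mono[of 1 "p powr p" "\<bar>d\<bar> powr p"] assms by (simp add: ge_one_powr_ge_zero)
    finally have "\<bar>1 - d\<bar> powr p \<le> p powr p * \<bar>d\<bar> powr p" .
    moreover have "p * d \<le> (p * d) * (2 * (p * d))"
      using mult_mono[of 1 p 1 d] 1 assms mult_left_mono[of 1 "2 * (p * d)" "p * d"] by auto
    ultimately show ?thesis by (simp add: power2_eq_square algebra_simps)
  next
    case 2
    have "ln (1 - d) \<le> - d" using 2 ln_le_minus_one[of "1 - d"] by simp
    then have "p * ln (1 - d) \<le> p * (- d)" using assms by (intro mult_left_mono) auto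
    then have "\<bar>1 - d\<bar> powr p \<le> exp (- p * d)" using 2 by (simp add: powr_def)
    also have "\<dots> \<le> 1 + (- p * d) + 2 * (- p * d)\<^sup>2" using 2 by (intro exp_le_quadratic)
    finally have "\<bar>1 - d\<bar> powr p \<le> 1 - p * d + 2 * p\<^sup>2 * d\<^sup>2" by (simp add: power_mult_distrib)
    then show ?thesis using nn by linarith
  next
    case 3
    then have "d < 0" using assms by (smt (verit) mult_nonneg_nonneg minus_mult_left)
    \<comment> \<open>1 - d <= - p d is the average of 2 < - p d and - 2 d <= - p d.\<close>
    have "2 * (p - 1) * (- d) \<ge> p * (- d)" using \<open>d < 0\<close> assms by (intro mult_right_mono) auto
    then have "2 * d \<ge> p * d" by (simp add: algebra_simps)
    moreover have "p * \<bar>d\<bar> = - p * d" using \<open>d < 0\<close> by simp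
    ultimately have "1 - d \<le> p * \<bar>d\<bar>" using 3 by linarith
    then have "\<bar>1 - d\<bar> powr p \<le> (p * \<bar>d\<bar>) powr p" using assms \<open>d < 0\<close> by (intro powr_mono2) auto
    also have "\<dots> = p powr p * \<bar>d\<bar> powr p" using assms by (simp add: powr_mult)
    finally show ?thesis using 3 by (smt (verit) mult_nonneg_nonneg zero_le_power2 minus_mult_left)
  qed
qed

text \<open>For nonzero r this is the previous bound at d = v / r, scaled by |r|^p. For r = 0 only
  the p-th powers matter, and p^p >= 1.\<close>

lemma powr_decrease_lower:
  fixes p r v :: real
  assumes "2 \<le> p"
  shows "p * weight p r * r * v - 2 * p\<^sup>2 * weight p r * v\<^sup>2 - p powr p * \<bar>v\<bar> powr p
    \<le> \<bar>r\<bar> powr p - \<bar>r - v\<bar> powr p"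
proof (cases "r = 0")
  case True
  have "\<bar>v\<bar> powr p \<le> p powr p * \<bar>v\<bar> powr p"
    using mult_right_mono[of 1 "p powr p" "\<bar>v\<bar> powr p"] assms by (simp add: ge_one_powr_ge_zero)
  moreover have "0 \<le> 2 * p\<^sup>2 * weight p r * v\<^sup>2" by simp
  moreover have "p * weight p r * r * v = 0" "\<bar>r\<bar> powr p - \<bar>r - v\<bar> powr p = - (\<bar>v\<bar> powr p)"
    using True by simp_all
  ultimately show ?thesis by linarith
next
  case False
  have "\<bar>r\<bar> powr p * \<bar>1 - v / r\<bar> powr p
      \<le> \<bar>r\<bar> powr p * (1 - p * (v / r) + 2 * p\<^sup>2 * (v / r)\<^sup>2 + p powr p * \<bar>v / r\<bar> powr p)"
    using one_minus_powr_upper[OF assms, of "v / r"] by (intro mult_left_mono) auto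
  moreover have "\<bar>r\<bar> powr p * \<bar>1 - v / r\<bar> powr p = \<bar>r - v\<bar> powr p"
  proof -
    have "\<bar>r\<bar> * \<bar>1 - v / r\<bar> = \<bar>r - v\<bar>"
      using False by (simp flip: abs_mult add: right_diff_distrib)
    then show ?thesis by (simp flip: powr_mult)
  qed
  moreover have "\<bar>r\<bar> powr p * (1 - p * (v / r) + 2 * p\<^sup>2 * (v / r)\<^sup>2 + p powr p * \<bar>v / r\<bar> powr p)
      = \<bar>r\<bar> powr p - p * weight p r * r * v + 2 * p\<^sup>2 * weight p r * v\<^sup>2 + p powr p * \<bar>v\<bar> powr p"
  proof -
    have 1: "\<bar>v\<bar> powr p = \<bar>r\<bar> powr p * \<bar>v / r\<bar> powr p"
      using False by (simp flip: powr_mult)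
    have 2: "weight p r * (r * v) = \<bar>r\<bar> powr p * (v / r)"
        and 3: "weight p r * v\<^sup>2 = \<bar>r\<bar> powr p * (v / r)\<^sup>2"
      using False by (simp_all flip: weight_mult_sq[OF assms] add: power2_eq_square)
    have "p * weight p r * r * v = p * (weight p r * (r * v))"
        "2 * p\<^sup>2 * weight p r * v\<^sup>2 = 2 * p\<^sup>2 * (weight p r * v\<^sup>2)"
      by (simp_all add: mult.assoc)
    then show ?thesis by (simp only: 1 2 3) (simp add: algebra_simps)
  qed
  ultimately show ?thesis by linarith
qed

section \<open>Comparison of the 2-norm and the p-norm\<close>

lemma sum_powr_le_powr_sum:
  fixes a :: "nat \<Rightarrow> real"
  assumes "2 \<le> p"
  shows "(\<Sum>j<m. \<bar>a j\<bar> powr p) \<le> (\<Sum>j<m. (a j)\<^sup>2) powr (p / 2)"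
proof (induction m)
  case (Suc m)
  have "(\<Sum>j<m. (a j)\<^sup>2) powr (p/2) + ((a m)\<^sup>2) powr (p/2) \<le> ((\<Sum>j<m. (a j)\<^sup>2) + (a m)\<^sup>2) powr (p/2)"
    using assms by (intro powr_superadditive) (auto intro: sum_nonneg)
  then show ?case using Suc by (simp add: powr_sq_half)
qed simp

text \<open>Jensen's inequality for z^(p/2): the tangents at the mean c of the squares are summed
  over j, and their linear parts cancel.\<close>

lemma powr_sum_le_sum_powr:
  fixes a :: "nat \<Rightarrow> real"
  assumes "2 \<le> p"
  shows "(\<Sum>j<m. (a j)\<^sup>2) powr (p / 2) \<le> real m powr ((p - 2) / 2) * (\<Sum>j<m. \<bar>a j\<bar> powr p)"
proof (cases "m = 0")
  case False
  define S where "S = (\<Sum>j<m. (a j)\<^sup>2)"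
  define c where "c = S / m"
  have "S \<ge> 0" by (auto simp: S_def intro: sum_nonneg)
  have centred: "(\<Sum>j<m. (a j)\<^sup>2 - c) = 0"
    using False by (simp add: sum_subtractf c_def flip: S_def)
  have "real m * c powr (p/2) = (\<Sum>j<m. c powr (p/2) + p/2 * c powr (p/2 - 1) * ((a j)\<^sup>2 - c))"
    unfolding sum.distrib sum_distrib_left[symmetric] centred by simp
  also have "\<dots> \<le> (\<Sum>j<m. ((a j)\<^sup>2) powr (p/2))"
    using assms \<open>S \<ge> 0\<close> by (intro sum_mono powr_above_tangent) (auto simp: c_def)
  finally have "m * c powr (p/2) \<le> (\<Sum>j<m. \<bar>a j\<bar> powr p)" by (simp add: powr_sq_half)
  then have "real m powr ((p - 2)/2) * (m * c powr (p/2)) \<le> real m powr ((p - 2)/2) * (\<Sum>j<m. \<bar>a j\<bar> powr p)"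
    by (intro mult_left_mono) auto
  moreover have "real m powr ((p - 2)/2) * (m * c powr (p/2)) = S powr (p/2)"
    using False \<open>S \<ge> 0\<close> by (simp add: c_def powr_divide diff_divide_distrib powr_diff)
  ultimately show ?thesis by (simp add: S_def)
qed simp

subsection \<open>Existence of minimisers\<close>

lemma attains_min_of_far_ge:
  fixes f :: "real \<Rightarrow> real"
  assumes "continuous_on UNIV f" "\<And>x. B < \<bar>x\<bar> \<Longrightarrow> f 0 \<le> f x"
  obtains x where "\<And>y. f x \<le> f y"
proof -
  define D where "D = \<bar>B\<bar>"
  have "\<exists>x\<in>{-D..D}. \<forall>y\<in>{-D..D}. f x \<le> f y"
    using assms(1) by (intro continuous_attains_inf) (auto simp: D_def intro: continuous_on_subset)
  then obtain x where x: "\<And>y. y \<in> {-D..D} \<Longrightarrow> f x \<le> f y" by blast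
  have "f x \<le> f y" for y
  proof (cases "y \<in> {-D..D}")
    case False
    then have "f 0 \<le> f y" by (intro assms(2)) (auto simp: D_def)
    moreover have "f x \<le> f 0" by (rule x) (simp add: D_def)
    ultimately show ?thesis by simp
  qed (rule x)
  then show ?thesis by (rule that)
qed

lemma line_search_exists:
  fixes r a :: "nat \<Rightarrow> real"
  assumes "2 \<le> p"
  obtains x where "\<And>y. (\<Sum>j<m. \<bar>r j - x * a j\<bar> powr p) \<le> (\<Sum>j<m. \<bar>r j - y * a j\<bar> powr p)"
proof (cases "\<forall>j<m. a j = 0")
  case True
  then have "(\<Sum>j<m. \<bar>r j - 0 * a j\<bar> powr p) \<le> (\<Sum>j<m. \<bar>r j - y * a j\<bar> powr p)" for y
    by (intro sum_mono) auto
  then show ?thesis by (rule that)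
next
  case False
  then obtain k where k: "k < m" "a k \<noteq> 0" by auto
  define f where "f y = (\<Sum>j<m. \<bar>r j - y * a j\<bar> powr p)" for y
  \<comment> \<open>Beyond this radius the k-th term alone reaches f 0.\<close>
  have "f 0 \<le> f y" if "(\<bar>r k\<bar> + f 0 powr (1/p)) / \<bar>a k\<bar> < \<bar>y\<bar>" for y
  proof -
    have "\<bar>r k\<bar> + f 0 powr (1/p) < \<bar>y * a k\<bar>"
      using that k by (simp add: field_simps abs_mult)
    then have "f 0 powr (1/p) \<le> \<bar>r k - y * a k\<bar>" by linarith
    then have "(f 0 powr (1/p)) powr p \<le> \<bar>r k - y * a k\<bar> powr p"
      using assms by (intro powr_mono2) auto
    also have "\<dots> \<le> f y"
      unfolding f_def using k by (intro member_le_sum) auto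
    finally show ?thesis using assms by (simp add: powr_powr f_def sum_nonneg)
  qed
  moreover have "continuous_on UNIV f"
    unfolding f_def using assms by (intro continuous_intros continuous_on_powr') auto
  ultimately show ?thesis
    using attains_min_of_far_ge[of f] that unfolding f_def by blast
qed

section \<open>Minimising sums of squares over affine sets\<close>

definition affine_set :: "nat \<Rightarrow> real vec set \<Rightarrow> bool" where
  "affine_set n F \<longleftrightarrow> F \<subseteq> carrier_vec n \<and> (\<forall>x\<in>F. \<forall>u\<in>F. \<forall>v\<in>F. \<forall>t. x + t \<cdot>\<^sub>v (u - v) \<in> F)"

text \<open>Sets and functions are both described through the move x + t (u - v), the only operation
  that the elimination performs; an affine set may thus be given by any linear constraints.\<close>

definition affine_fun_on :: "real vec set \<Rightarrow> (real vec \<Rightarrow> real) \<Rightarrow> bool" where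
  "affine_fun_on F f \<longleftrightarrow>
     (\<forall>x\<in>F. \<forall>u\<in>F. \<forall>v\<in>F. \<forall>t. f (x + t \<cdot>\<^sub>v (u - v)) = f x + t * (f u - f v))"

lemma affine_setD:
  assumes "affine_set n F" "x \<in> F" "u \<in> F" "v \<in> F"
  shows "x + t \<cdot>\<^sub>v (u - v) \<in> F"
  using assms by (auto simp: affine_set_def)

lemma affine_fun_onD:
  assumes "affine_fun_on F f" "x \<in> F" "u \<in> F" "v \<in> F"
  shows "f (x + t \<cdot>\<^sub>v (u - v)) = f x + t * (f u - f v)"
  using assms by (auto simp: affine_fun_on_def)

text \<open>The left side is the value at the vertex of a parabola in t. If all c j vanish, the
  quotient has denominator 0, but it is multiplied by c j = 0.\<close>

lemma sum_sq_line_min: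
  fixes c b :: "nat \<Rightarrow> real"
  shows "(\<Sum>j<M. (b j - (\<Sum>j<M. b j * c j) / (\<Sum>j<M. (c j)\<^sup>2) * c j)\<^sup>2) \<le> (\<Sum>j<M. (b j + t * c j)\<^sup>2)"
proof -
  define S where "S = (\<Sum>j<M. (c j)\<^sup>2)"
  define B where "B = (\<Sum>j<M. b j * c j)"
  have expand: "(\<Sum>j<M. (b j + s * c j)\<^sup>2) = (\<Sum>j<M. (b j)\<^sup>2) + 2 * s * B + s\<^sup>2 * S" for s
    unfolding S_def B_def by (simp add: power2_sum power_mult_distrib sum.distrib sum_distrib_left mult_ac)
  show ?thesis
  proof (cases "S = 0")
    case True
    then have "c j = 0" if "j < M" for j
      using that by (auto simp: S_def sum_nonneg_eq_0_iff)
    then show ?thesis by simp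
  next
    case False
    then have "S > 0" by (auto simp: S_def less_le intro!: sum_nonneg)
    have "2 * t * B + t\<^sup>2 * S - (2 * (- B / S) * B + (- B / S)\<^sup>2 * S) = S * (t + B / S)\<^sup>2"
      using \<open>S > 0\<close> by (simp add: power2_eq_square field_simps)
    also have "\<dots> \<ge> 0" using \<open>S > 0\<close> by simp
    finally have "(\<Sum>j<M. (b j + (- B / S) * c j)\<^sup>2) \<le> (\<Sum>j<M. (b j + t * c j)\<^sup>2)"
      unfolding expand by simp
    then show ?thesis by (simp add: S_def B_def)
  qed
qed

(* Induction on the number of free coordinates: minimising along a direction that moves the last
   free coordinate keeps the function a sum of squares of affine functions. *)
lemma sum_sq_attains_min_aux:
  fixes f :: "nat \<Rightarrow> real vec \<Rightarrow> real"
  assumes "affine_set n F" "F \<noteq> {}" "\<And>j. affine_fun_on F (f j)"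
    "\<And>x y i. x \<in> F \<Longrightarrow> y \<in> F \<Longrightarrow> k \<le> i \<Longrightarrow> i < n \<Longrightarrow> x $ i = y $ i"
  shows "\<exists>x\<in>F. \<forall>y\<in>F. (\<Sum>j<M. (f j x)\<^sup>2) \<le> (\<Sum>j<M. (f j y)\<^sup>2)"
  using assms
proof (induction k arbitrary: F f)
  case 0
  then obtain x where "x \<in> F" by auto
  moreover have "y = x" if "y \<in> F" for y
  proof (rule eq_vecI)
    have "dim_vec x = n" "dim_vec y = n"
      using \<open>x \<in> F\<close> that 0(1) by (auto simp: affine_set_def)
    then show "dim_vec y = dim_vec x" "\<And>i. i < dim_vec x \<Longrightarrow> y $ i = x $ i"
      using 0(4)[OF \<open>y \<in> F\<close> \<open>x \<in> F\<close>] by simp_all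
  qed
  ultimately show ?case by auto
next
  case (Suc k)
  show ?case
  proof (cases "\<forall>x\<in>F. \<forall>y\<in>F. k < n \<longrightarrow> x $ k = y $ k")
    case True
    show ?thesis
    proof (rule Suc.IH[OF Suc.prems(1-3)])
      fix x y i assume *: "x \<in> F" "y \<in> F" "k \<le> i" "i < n"
      have "k < n \<longrightarrow> x $ k = y $ k" using True *(1,2) by blast
      then show "x $ i = y $ i"
        using * Suc.prems(4)[OF *(1,2), of i] by (cases "i = k") auto
    qed
  next
    case False
    then obtain u v where uv: "u \<in> F" "v \<in> F" "k < n" "u $ k \<noteq> v $ k" by blast
    have carr: "x \<in> carrier_vec n" "dim_vec x = n" if "x \<in> F" for x
      using Suc.prems(1) that by (auto simp: affine_set_def)
    define w where "w = u - v"
    define c where "c j = f j u - f j v" for j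
    \<comment> \<open>\<tau> x is the optimal step from x along w. Its denominator does not depend
      on x, so \<tau> is affine, and hence so is g j, the value of f j after that step.\<close>
    define \<tau> where "\<tau> x = - (\<Sum>j<M. f j x * c j) / (\<Sum>j<M. (c j)\<^sup>2)" for x
    define g where "g j x = f j x + \<tau> x * c j" for j x
    define F' where "F' = {x \<in> F. x $ k = u $ k}"
    \<comment> \<open>\<pi> projects F along w onto the slice F', on which coordinate k is fixed as
      well.\<close>
    define \<sigma> where "\<sigma> x = (u $ k - x $ k) / (u $ k - v $ k)" for x
    define \<pi> where "\<pi> x = x + \<sigma> x \<cdot>\<^sub>v w" for x
    have \<pi>: "\<pi> x \<in> F'" if "x \<in> F" for x
      using affine_setD[OF Suc.prems(1) that uv(1,2)] carr(2)[OF that] carr(2)[OF uv(2)] uv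
      by (simp add: F'_def \<pi>_def w_def \<sigma>_def)
    have f_move: "f j (x + t \<cdot>\<^sub>v w) = f j x + t * c j" if "x \<in> F" for x t j
      using affine_fun_onD[OF Suc.prems(3) that uv(1,2)] by (simp add: w_def c_def)
    have "affine_set n F'"
      unfolding affine_set_def
    proof (intro conjI ballI allI)
      fix x y z t assume "x \<in> F'" "y \<in> F'" "z \<in> F'"
      then show "x + t \<cdot>\<^sub>v (y - z) \<in> F'"
        using affine_setD[OF Suc.prems(1), of x y z] carr(2)[of x] carr(2)[of z] uv(3)
        by (simp add: F'_def)
    qed (use carr(1) in \<open>auto simp: F'_def\<close>)
    moreover have "F' \<noteq> {}" using uv by (auto simp: F'_def)
    moreover have "affine_fun_on F' (g j)" for j
    proof -
      have \<tau>: "\<tau> (x + t \<cdot>\<^sub>v (y - z)) = \<tau> x + t * (\<tau> y - \<tau> z)" if "x \<in> F" "y \<in> F" "z \<in> F" for x y z t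
      proof -
        have num: "(\<Sum>j<M. f j (x + t \<cdot>\<^sub>v (y - z)) * c j)
            = (\<Sum>j<M. f j x * c j) + t * ((\<Sum>j<M. f j y * c j) - (\<Sum>j<M. f j z * c j))"
          unfolding affine_fun_onD[OF Suc.prems(3) that]
          by (simp add: algebra_simps sum.distrib sum_subtractf sum_distrib_left)
        show ?thesis unfolding \<tau>_def num by (simp add: diff_divide_distrib add_divide_distrib algebra_simps)
      qed
      show ?thesis
        unfolding affine_fun_on_def
      proof (intro ballI allI)
        fix x y z t assume "x \<in> F'" "y \<in> F'" "z \<in> F'"
        then have *: "x \<in> F" "y \<in> F" "z \<in> F" by (auto simp: F'_def)
        show "g j (x + t \<cdot>\<^sub>v (y - z)) = g j x + t * (g j y - g j z)"
          unfolding g_def \<tau>[OF *] affine_fun_onD[OF Suc.prems(3) *] by (simp add: algebra_simps)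
      qed
    qed
    moreover have "x $ i = y $ i" if "x \<in> F'" "y \<in> F'" "k \<le> i" "i < n" for x y i
      using that Suc.prems(4)[of x y i] by (cases "i = k") (auto simp: F'_def)
    ultimately obtain x where x: "x \<in> F'"
        "\<And>y. y \<in> F' \<Longrightarrow> (\<Sum>j<M. (g j x)\<^sup>2) \<le> (\<Sum>j<M. (g j y)\<^sup>2)"
      using Suc.IH[of F' g] by blast
    have "x \<in> F" using x by (simp add: F'_def)
    show ?thesis
    proof (intro bexI ballI)
      show "x + \<tau> x \<cdot>\<^sub>v w \<in> F"
        unfolding w_def using affine_setD[OF Suc.prems(1) \<open>x \<in> F\<close> uv(1,2)] .
      fix y assume "y \<in> F"
      have "\<pi> y \<in> F" using \<pi>[OF \<open>y \<in> F\<close>] by (simp add: F'_def)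
      \<comment> \<open>y and \<pi> y lie on one line in direction w, and the values g j (\<pi> y)
        belong to the minimum over that line.\<close>
      have "f j y = f j (\<pi> y) + (- \<sigma> y) * c j" for j
        using f_move[OF \<open>y \<in> F\<close>] by (simp add: \<pi>_def)
      then have "(\<Sum>j<M. (g j (\<pi> y))\<^sup>2) \<le> (\<Sum>j<M. (f j y)\<^sup>2)"
        unfolding g_def \<tau>_def
        using sum_sq_line_min[where b = "\<lambda>j. f j (\<pi> y)" and c = c and t = "- \<sigma> y"] by simp
      moreover have "(\<Sum>j<M. (f j (x + \<tau> x \<cdot>\<^sub>v w))\<^sup>2) = (\<Sum>j<M. (g j x)\<^sup>2)"
        using f_move[OF \<open>x \<in> F\<close>] by (simp add: g_def)
      ultimately show "(\<Sum>j<M. (f j (x + \<tau> x \<cdot>\<^sub>v w))\<^sup>2) \<le> (\<Sum>j<M. (f j y)\<^sup>2)"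
        using x(2)[OF \<pi>[OF \<open>y \<in> F\<close>]] by linarith
    qed
  qed
qed

lemma sum_sq_attains_min:
  fixes f :: "nat \<Rightarrow> real vec \<Rightarrow> real"
  assumes "affine_set n F" "F \<noteq> {}" "\<And>j. j < M \<Longrightarrow> affine_fun_on F (f j)"
  shows "\<exists>x\<in>F. \<forall>y\<in>F. (\<Sum>j<M. (f j x)\<^sup>2) \<le> (\<Sum>j<M. (f j y)\<^sup>2)"
proof -
  have "\<exists>x\<in>F. \<forall>y\<in>F. (\<Sum>j<M. (if j < M then f j x else 0)\<^sup>2) \<le> (\<Sum>j<M. (if j < M then f j y else 0)\<^sup>2)"
    using assms by (intro sum_sq_attains_min_aux[where n = n and k = n]) (auto simp: affine_fun_on_def)
  then show ?thesis by simp
qed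

subsection \<open>The quantities of the algorithm as finite sums\<close>

lemma pnorm_powr:
  assumes "0 < p"
  shows "pnorm p v powr p = (\<Sum>j<dim_vec v. \<bar>v $ j\<bar> powr p)"
  using assms by (simp add: pnorm_def powr_powr sum_nonneg)

lemma quadratic_form_diag:
  fixes A :: "real mat"
  assumes A: "A \<in> carrier_mat m n" and x: "x \<in> carrier_vec n"
  shows "x \<bullet> ((A\<^sup>T * mat_diag m h * A) *\<^sub>v x) = (\<Sum>j<m. h j * ((A *\<^sub>v x) $ j)\<^sup>2)"
proof -
  let ?D = "mat_diag m h"
  have Ax: "A *\<^sub>v x \<in> carrier_vec m" using A x by simp
  then have DAx: "?D *\<^sub>v (A *\<^sub>v x) \<in> carrier_vec m" by (rule mult_mat_vec_carrier[OF mat_diag_dim])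
  have "(A\<^sup>T * ?D * A) *\<^sub>v x = A\<^sup>T *\<^sub>v (?D *\<^sub>v (A *\<^sub>v x))"
    using A x by (simp add: assoc_mult_mat_vec[of _ n m _ n] assoc_mult_mat_vec[of _ n m _ m])
  then have "x \<bullet> ((A\<^sup>T * ?D * A) *\<^sub>v x) = (A\<^sup>T *\<^sub>v (?D *\<^sub>v (A *\<^sub>v x))) \<bullet> x"
    using A x comm_scalar_prod[OF x, of "A\<^sup>T *\<^sub>v (?D *\<^sub>v (A *\<^sub>v x))"]
      mult_mat_vec_carrier[OF _ DAx, of "A\<^sup>T" n] by simp
  also have "\<dots> = (?D *\<^sub>v (A *\<^sub>v x)) \<bullet> (A *\<^sub>v x)"
    using A x DAx by (rule transpose_vec_mult_scalar)
  also have "\<dots> = (\<Sum>j<m. (?D *\<^sub>v (A *\<^sub>v x)) $ j * (A *\<^sub>v x) $ j)"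
    using A by (simp add: scalar_prod_def lessThan_atLeast0)
  also have "\<dots> = (\<Sum>j<m. h j * ((A *\<^sub>v x) $ j)\<^sup>2)"
  proof (rule sum.cong)
    fix j assume "j \<in> {..<m}"
    then have j: "j < m" by simp
    have "(?D *\<^sub>v (A *\<^sub>v x)) $ j = (\<Sum>k<m. (if j = k then h j else 0) * (A *\<^sub>v x) $ k)"
      using j A by (auto simp: scalar_prod_def lessThan_atLeast0 mat_diag_def intro!: sum.cong)
    also have "\<dots> = (\<Sum>k<m. if j = k then h j * (A *\<^sub>v x) $ k else 0)"
      by (intro sum.cong) auto
    also have "\<dots> = h j * (A *\<^sub>v x) $ j" using j by simp
    finally show "(?D *\<^sub>v (A *\<^sub>v x)) $ j * (A *\<^sub>v x) $ j = h j * ((A *\<^sub>v x) $ j)\<^sup>2"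
      by (simp add: power2_eq_square)
  qed simp
  finally show ?thesis .
qed

locale irls =
  fixes p :: real and A :: "real mat" and b :: "real vec" and C :: "real mat" and d :: "real vec"
    and m n l :: nat
  assumes p: "2 \<le> p" and A: "A \<in> carrier_mat m n" and b: "b \<in> carrier_vec m"
    and C: "C \<in> carrier_mat l n" and d: "d \<in> carrier_vec l"
begin

abbreviation "f \<equiv> objective p A b"
abbreviation "feas \<equiv> feasible n C d"

definition "im x j = (A *\<^sub>v x) $ j"
definition "rs x j = im x j - b $ j"
definition "wt x j = weight p (rs x j)"
definition "grad x \<Delta> = (\<Sum>j<m. p * wt x j * rs x j * im \<Delta> j)"
definition "wsq x \<Delta> = (\<Sum>j<m. wt x j * (im \<Delta> j)\<^sup>2)"
definition "nsq \<Delta> = (\<Sum>j<m. (im \<Delta> j)\<^sup>2)"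
definition "npow \<Delta> = (\<Sum>j<m. \<bar>im \<Delta> j\<bar> powr p)"
definition "energy x i \<Delta> = wsq x \<Delta> + padding p m i * nsq \<Delta>"

lemma dims [simp]: "dim_row A = m" "dim_col A = n" "dim_vec b = m" "dim_row C = l" "dim_col C = n" "dim_vec d = l"
  using A b C d by auto

lemma index_residual_vec: "j < m \<Longrightarrow> (A *\<^sub>v x - b) $ j = rs x j"
  by (simp add: rs_def im_def)

lemma objective_eq: "f x = (\<Sum>j<m. \<bar>rs x j\<bar> powr p)"
  using p by (simp add: objective_def pnorm_powr) (simp add: rs_def im_def)

lemma npow_eq: "pnorm p (A *\<^sub>v \<Delta>) powr p = npow \<Delta>"
  using p by (simp add: pnorm_powr npow_def im_def)

lemma pnorm_two_sq: "(pnorm 2 (A *\<^sub>v x - b))\<^sup>2 = (\<Sum>j<m. (rs x j)\<^sup>2)"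
proof -
  have "(pnorm 2 (A *\<^sub>v x - b))\<^sup>2 = pnorm 2 (A *\<^sub>v x - b) powr 2"
    by (simp add: pnorm_def)
  also have "\<dots> = (\<Sum>j<m. (rs x j)\<^sup>2)"
    by (subst pnorm_powr) (auto simp: rs_def im_def intro!: sum.cong)
  finally show ?thesis .
qed

lemma weights_eq: "weights p A b x = mat_diag m (wt x)"
  by (rule eq_matI)
    (auto simp: weights_def diag_of_vec_def mat_diag_def abs_powr_vec_def wt_def weight_def
      index_residual_vec simp del: index_minus_vec(1))

lemma gradient_eq:
  assumes "x \<in> carrier_vec n" "\<Delta> \<in> carrier_vec n"
  shows "gradient p A b x \<bullet> (A *\<^sub>v \<Delta>) = grad x \<Delta>"
proof -
  have "gradient p A b x $ j = p * wt x j * rs x j" if j: "j < m" for j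
  proof -
    have "(weights p A b x *\<^sub>v (A *\<^sub>v x - b)) $ j = (\<Sum>k<m. (if j = k then wt x j else 0) * rs x k)"
      using j A by (auto simp: weights_eq scalar_prod_def lessThan_atLeast0 mat_diag_def index_residual_vec
        simp del: index_minus_vec(1) intro!: sum.cong)
    also have "\<dots> = (\<Sum>k<m. if j = k then wt x j * rs x k else 0)"
      by (intro sum.cong) auto
    also have "\<dots> = wt x j * rs x j" using j by simp
    finally show ?thesis
      using j by (simp add: gradient_def weights_eq del: index_mult_mat_vec)
        (simp add: mat_diag_def del: index_mult_mat_vec(1))
  qed
  then show ?thesis
    by (simp add: scalar_prod_def lessThan_atLeast0 grad_def im_def)
qed

lemma wsq_eq:
  assumes "\<Delta> \<in> carrier_vec n"
  shows "\<Delta> \<bullet> ((A\<^sup>T * weights p A b x * A) *\<^sub>v \<Delta>) = wsq x \<Delta>"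
  using quadratic_form_diag[OF A assms] by (simp add: weights_eq wsq_def im_def)

lemma padded_energy_eq:
  assumes "\<Delta> \<in> carrier_vec n"
  shows "padded_energy p A b x i \<Delta> = energy x i \<Delta>"
proof -
  have "weights p A b x + padding p m i \<cdot>\<^sub>m 1\<^sub>m m = mat_diag m (\<lambda>j. wt x j + padding p m i)"
    by (rule eq_matI) (auto simp: weights_eq mat_diag_def)
  then show ?thesis
    using quadratic_form_diag[OF A assms]
    by (simp add: padded_energy_def energy_def wsq_def nsq_def im_def algebra_simps sum.distrib sum_distrib_left)
qed

lemma residual_eq:
  assumes "x \<in> carrier_vec n" "\<Delta> \<in> carrier_vec n"
  shows "residual p A b x \<Delta> = grad x \<Delta> - 2 * p\<^sup>2 * wsq x \<Delta> - p powr p * npow \<Delta>"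
  using assms by (simp add: residual_def gradient_eq wsq_eq npow_eq)

lemma im_smult: "\<Delta> \<in> carrier_vec n \<Longrightarrow> j < m \<Longrightarrow> im (a \<cdot>\<^sub>v \<Delta>) j = a * im \<Delta> j"
  by (simp add: im_def mult_mat_vec[OF A])

lemma im_diff: "x \<in> carrier_vec n \<Longrightarrow> y \<in> carrier_vec n \<Longrightarrow> j < m \<Longrightarrow> im (x - y) j = im x j - im y j"
  by (simp add: im_def mult_minus_distrib_mat_vec[OF A] del: index_mult_mat_vec)

lemma im_add: "x \<in> carrier_vec n \<Longrightarrow> y \<in> carrier_vec n \<Longrightarrow> j < m \<Longrightarrow> im (x + y) j = im x j + im y j"
  by (simp add: im_def mult_add_distrib_mat_vec[OF A] del: index_mult_mat_vec)

lemma rs_move: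
  "x \<in> carrier_vec n \<Longrightarrow> \<Delta> \<in> carrier_vec n \<Longrightarrow> j < m \<Longrightarrow> rs (x - a \<cdot>\<^sub>v \<Delta>) j = rs x j - a * im \<Delta> j"
  by (simp add: rs_def im_diff im_smult)

lemma objective_move:
  assumes "x \<in> carrier_vec n" "\<Delta> \<in> carrier_vec n"
  shows "f (x - a \<cdot>\<^sub>v \<Delta>) = (\<Sum>j<m. \<bar>rs x j - a * im \<Delta> j\<bar> powr p)"
  using assms by (simp add: objective_eq rs_move)

lemma grad_smult: "\<Delta> \<in> carrier_vec n \<Longrightarrow> grad x (a \<cdot>\<^sub>v \<Delta>) = a * grad x \<Delta>"
  by (simp add: grad_def im_smult sum_distrib_left mult_ac)

lemma wsq_smult: "\<Delta> \<in> carrier_vec n \<Longrightarrow> wsq x (a \<cdot>\<^sub>v \<Delta>) = a\<^sup>2 * wsq x \<Delta>"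
  by (simp add: wsq_def im_smult sum_distrib_left power_mult_distrib mult_ac)

lemma npow_smult: "\<Delta> \<in> carrier_vec n \<Longrightarrow> npow (a \<cdot>\<^sub>v \<Delta>) = \<bar>a\<bar> powr p * npow \<Delta>"
  by (simp add: npow_def im_smult sum_distrib_left abs_mult powr_mult)

lemma wsq_nonneg: "0 \<le> wsq x \<Delta>"
  by (simp add: wsq_def wt_def sum_nonneg)

lemma nsq_nonneg: "0 \<le> nsq \<Delta>"
  by (simp add: nsq_def sum_nonneg)

lemma npow_nonneg: "0 \<le> npow \<Delta>"
  by (simp add: npow_def sum_nonneg)

lemma padding_nonneg: "0 \<le> padding p m i"
  by (simp add: padding_def)

lemma objective_nonneg: "0 \<le> f x"
  by (simp add: objective_def)

lemma decrease_ge_residual: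
  assumes "x \<in> carrier_vec n" "\<Delta> \<in> carrier_vec n"
  shows "residual p A b x \<Delta> \<le> f x - f (x - \<Delta>)"
proof -
  have "residual p A b x \<Delta>
      = (\<Sum>j<m. p * wt x j * rs x j * im \<Delta> j - 2 * p\<^sup>2 * wt x j * (im \<Delta> j)\<^sup>2 - p powr p * \<bar>im \<Delta> j\<bar> powr p)"
    using assms by (simp add: residual_eq grad_def wsq_def npow_def sum_subtractf sum_distrib_left mult_ac)
  also have "\<dots> \<le> (\<Sum>j<m. \<bar>rs x j\<bar> powr p - \<bar>rs x j - im \<Delta> j\<bar> powr p)"
    unfolding wt_def by (intro sum_mono powr_decrease_lower p)
  also have "\<dots> = f x - f (x - \<Delta>)"
    using objective_move[OF assms, of 1] by (simp add: objective_eq sum_subtractf)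
  finally show ?thesis .
qed

text \<open>Read at \<open>x - y\<close> for a better point y: a large gap forces a large gradient
  term and limits the weighted and p-th power sizes of the direction.\<close>

lemma decrease_le:
  assumes "x \<in> carrier_vec n" "\<Delta> \<in> carrier_vec n"
  shows "f x - f (x - \<Delta>) \<le> grad x \<Delta> - p / 4 * wsq x \<Delta> - 2 powr (1 - p) * npow \<Delta>"
proof -
  have "f x - f (x - \<Delta>) = (\<Sum>j<m. \<bar>rs x j\<bar> powr p - \<bar>rs x j - im \<Delta> j\<bar> powr p)"
    using objective_move[OF assms, of 1] by (simp add: objective_eq sum_subtractf)
  also have "\<dots> \<le> (\<Sum>j<m. p * wt x j * rs x j * im \<Delta> j - p / 4 * wt x j * (im \<Delta> j)\<^sup>2 - 2 powr (1 - p) * \<bar>im \<Delta> j\<bar> powr p)"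
    unfolding wt_def by (intro sum_mono powr_decrease_upper p)
  also have "\<dots> = grad x \<Delta> - p / 4 * wsq x \<Delta> - 2 powr (1 - p) * npow \<Delta>"
    by (simp add: grad_def wsq_def npow_def sum_subtractf sum_distrib_left mult_ac)
  finally show ?thesis .
qed

lemma feas_move:
  assumes "feas x" "\<Delta> \<in> carrier_vec n" "C *\<^sub>v \<Delta> = 0\<^sub>v l"
  shows "feas (x - a \<cdot>\<^sub>v \<Delta>)"
proof -
  have x: "x \<in> carrier_vec n" "C *\<^sub>v x = d" using assms(1) by (simp_all add: feasible_def)
  then have "C *\<^sub>v (x - a \<cdot>\<^sub>v \<Delta>) = d - a \<cdot>\<^sub>v 0\<^sub>v l"
    using assms(2,3) by (simp add: mult_minus_distrib_mat_vec[OF C] mult_mat_vec[OF C] del: index_mult_mat_vec)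
  also have "\<dots> = d" by (intro eq_vecI) auto
  finally show ?thesis using x assms(2) by (simp add: feasible_def)
qed

lemma direction_feasible_iff:
  assumes "x \<in> carrier_vec n"
  shows "direction_feasible p A b C x i \<Delta> \<longleftrightarrow> \<Delta> \<in> carrier_vec n \<and> grad x \<Delta> = i / 2 \<and> C *\<^sub>v \<Delta> = 0\<^sub>v l"
  using assms by (auto simp: direction_feasible_def gradient_eq)

section \<open>Existence of the starting point, the direction and the next state\<close>

lemma im_affine:
  assumes "x \<in> carrier_vec n" "u \<in> carrier_vec n" "v \<in> carrier_vec n" "j < m"
  shows "im (x + t \<cdot>\<^sub>v (u - v)) j = im x j + t * (im u j - im v j)"
  using assms by (simp add: im_add im_smult im_diff)

lemma least_squares_exists:
  assumes "\<exists>x. feas x"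
  obtains x where "is_arg_min (\<lambda>x. (pnorm 2 (A *\<^sub>v x - b))\<^sup>2) (feasible (dim_col A) C d) x"
proof -
  define F where "F = {x. feas x}"
  have F: "F \<subseteq> carrier_vec n" by (auto simp: F_def feasible_def)
  have "affine_set n F"
    unfolding affine_set_def
  proof (intro conjI ballI allI F)
    fix x u v t assume *: "x \<in> F" "u \<in> F" "v \<in> F"
    then have "C *\<^sub>v (x + t \<cdot>\<^sub>v (u - v)) = d + t \<cdot>\<^sub>v (d - d)"
      using C F by (simp add: F_def feasible_def mult_add_distrib_mat_vec[OF C]
          mult_mat_vec[OF C] mult_minus_distrib_mat_vec[OF C])
    also have "\<dots> = d" using d by (intro eq_vecI) auto
    finally show "x + t \<cdot>\<^sub>v (u - v) \<in> F" using * by (auto simp: F_def feasible_def)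
  qed
  moreover have "F \<noteq> {}" using assms by (auto simp: F_def)
  moreover have "affine_fun_on F (\<lambda>x. rs x j)" if "j < m" for j
    using im_affine[OF _ _ _ that] F by (auto simp: affine_fun_on_def rs_def subset_iff)
  ultimately have "\<exists>x\<in>F. \<forall>y\<in>F. (\<Sum>j<m. (rs x j)\<^sup>2) \<le> (\<Sum>j<m. (rs y j)\<^sup>2)"
    by (rule sum_sq_attains_min)
  then obtain x where "x \<in> F" "\<And>y. y \<in> F \<Longrightarrow> (\<Sum>j<m. (rs x j)\<^sup>2) \<le> (\<Sum>j<m. (rs y j)\<^sup>2)"
    by blast
  then have "is_arg_min (\<lambda>x. (pnorm 2 (A *\<^sub>v x - b))\<^sup>2) (feasible (dim_col A) C d) x"
    by (auto simp: is_arg_min_linorder pnorm_two_sq F_def)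
  then show ?thesis by (rule that)
qed

lemma direction_exists:
  assumes x: "x \<in> carrier_vec n" and "\<exists>\<Delta>. direction_feasible p A b C x i \<Delta>"
  obtains \<Delta> where "is_arg_min (padded_energy p A b x i) (direction_feasible p A b C x i) \<Delta>"
proof -
  define F where "F = {\<Delta>. direction_feasible p A b C x i \<Delta>}"
  have F: "F \<subseteq> carrier_vec n" by (auto simp: F_def direction_feasible_def)
  have grad_affine: "grad x (y + t \<cdot>\<^sub>v (u - v)) = grad x y + t * (grad x u - grad x v)"
    if "y \<in> carrier_vec n" "u \<in> carrier_vec n" "v \<in> carrier_vec n" for y u v t
    using that by (simp add: grad_def im_affine algebra_simps sum.distrib sum_subtractf sum_distrib_left)
  have "affine_set n F"
    unfolding affine_set_def
  proof (intro conjI ballI allI F)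
    fix y u v t assume *: "y \<in> F" "u \<in> F" "v \<in> F"
    then have carr: "y \<in> carrier_vec n" "u \<in> carrier_vec n" "v \<in> carrier_vec n"
      using F by auto
    have "C *\<^sub>v y = 0\<^sub>v l" "C *\<^sub>v u = 0\<^sub>v l" "C *\<^sub>v v = 0\<^sub>v l"
      using * by (simp_all add: F_def direction_feasible_def)
    then have "C *\<^sub>v (y + t \<cdot>\<^sub>v (u - v)) = 0\<^sub>v l + t \<cdot>\<^sub>v (0\<^sub>v l - 0\<^sub>v l)"
      using carr by (simp add: mult_add_distrib_mat_vec[OF C]
          mult_mat_vec[OF C] mult_minus_distrib_mat_vec[OF C] del: index_mult_mat_vec)
    also have "\<dots> = 0\<^sub>v l" by (intro eq_vecI) auto
    finally have "C *\<^sub>v (y + t \<cdot>\<^sub>v (u - v)) = 0\<^sub>v l" .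
    then show "y + t \<cdot>\<^sub>v (u - v) \<in> F"
      using * x carr by (simp add: F_def direction_feasible_iff grad_affine)
  qed
  moreover have "F \<noteq> {}" using assms by (auto simp: F_def)
  \<comment> \<open>The square root presents the padded energy as a sum of squares of affine
    functions.\<close>
  moreover have "affine_fun_on F (\<lambda>y. sqrt (wt x j + padding p m i) * im y j)" if "j < m" for j
    unfolding affine_fun_on_def
  proof (intro ballI allI)
    fix y u v t assume "y \<in> F" "u \<in> F" "v \<in> F"
    then have "y \<in> carrier_vec n" "u \<in> carrier_vec n" "v \<in> carrier_vec n" using F by auto
    then have "im (y + t \<cdot>\<^sub>v (u - v)) j = im y j + t * (im u j - im v j)"
      by (rule im_affine[OF _ _ _ that])
    then show "sqrt (wt x j + padding p m i) * im (y + t \<cdot>\<^sub>v (u - v)) j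
        = sqrt (wt x j + padding p m i) * im y j
          + t * (sqrt (wt x j + padding p m i) * im u j - sqrt (wt x j + padding p m i) * im v j)"
      by (simp only:) (simp add: algebra_simps)
  qed
  ultimately have "\<exists>\<Delta>\<in>F. \<forall>y\<in>F. (\<Sum>j<m. (sqrt (wt x j + padding p m i) * im \<Delta> j)\<^sup>2)
      \<le> (\<Sum>j<m. (sqrt (wt x j + padding p m i) * im y j)\<^sup>2)"
    by (rule sum_sq_attains_min)
  then obtain \<Delta> where \<Delta>: "\<Delta> \<in> F" "\<And>y. y \<in> F \<Longrightarrow>
      (\<Sum>j<m. (sqrt (wt x j + padding p m i) * im \<Delta> j)\<^sup>2) \<le> (\<Sum>j<m. (sqrt (wt x j + padding p m i) * im y j)\<^sup>2)"
    by blast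
  have "(\<Sum>j<m. (sqrt (wt x j + padding p m i) * im y j)\<^sup>2) = energy x i y" for y
    using padding_nonneg
    by (simp add: power_mult_distrib wt_def energy_def wsq_def nsq_def algebra_simps sum.distrib sum_distrib_left)
  then have "is_arg_min (padded_energy p A b x i) (direction_feasible p A b C x i) \<Delta>"
    using \<Delta> F by (auto simp: is_arg_min_linorder F_def padded_energy_eq subset_iff)
  then show ?thesis by (rule that)
qed

lemma step_exists:
  assumes "x \<in> carrier_vec n"
  obtains x' i' where "irls_step p A b C x i x' i'"
proof (cases "\<exists>\<Delta>. direction_feasible p A b C x i \<Delta>")
  case True
  then obtain \<Delta> where \<Delta>: "is_arg_min (padded_energy p A b x i) (direction_feasible p A b C x i) \<Delta>"
    using direction_exists[OF assms] by blast
  then have "\<Delta> \<in> carrier_vec n" by (simp add: is_arg_min_def direction_feasible_def)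
  obtain a where "\<And>y. f (x - a \<cdot>\<^sub>v \<Delta>) \<le> f (x - y \<cdot>\<^sub>v \<Delta>)"
    using line_search_exists[OF p, where m = m and r = "rs x" and a = "im \<Delta>"]
    unfolding objective_move[OF assms \<open>\<Delta> \<in> carrier_vec n\<close>] by blast
  then have "is_arg_min (\<lambda>\<alpha>. f (x - \<alpha> \<cdot>\<^sub>v \<Delta>)) (\<lambda>\<alpha>. True) a"
    by (simp add: is_arg_min_linorder)
  then show ?thesis using irls_step.move[OF \<Delta>] that by blast
next
  case False
  then show ?thesis using irls_step.stay that by blast
qed

subsection \<open>Progress of one iteration\<close>

text \<open>M^(p-1) = m^((p-2)/2) is the power of m in the bound on k.\<close>

definition M :: real where "M = real m powr ((p - 2) / (2 * (p - 1)))"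

text \<open>Hoelder's inequality; its power of m is the one that \<open>padding\<close> divides
  by.\<close>

lemma nsq_powr_le: "nsq \<Delta> \<le> real m powr ((p - 2) / p) * npow \<Delta> powr (2 / p)"
proof -
  have "nsq \<Delta> = (nsq \<Delta> powr (p / 2)) powr (2 / p)"
    using p nsq_nonneg[of \<Delta>] by (simp add: powr_powr)
  also have "\<dots> \<le> (real m powr ((p - 2) / 2) * npow \<Delta>) powr (2 / p)"
    using p powr_sum_le_sum_powr[OF p, of "im \<Delta>" m]
    by (intro powr_mono2) (auto simp: nsq_def npow_def)
  also have "\<dots> = real m powr ((p - 2) / p) * npow \<Delta> powr (2 / p)"
  proof -
    have "(p - 2) / 2 * (2 / p) = (p - 2) / p" using p by (simp add: field_simps)
    then show ?thesis
      using npow_nonneg[of \<Delta>] by (simp only: powr_mult powr_powr)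
  qed
  finally show ?thesis .
qed

lemma npow_le_nsq_powr: "npow \<Delta> \<le> nsq \<Delta> powr (p / 2)"
  using sum_powr_le_powr_sum[OF p, of "im \<Delta>" m] by (simp add: npow_def nsq_def)

text \<open>Since the gap exceeds H = 8 p i, so does the gradient G along D = x - y, and the
  quadratic and p-th power terms have to fit into G - H. Scaling by t makes the gradient i / 2; the
  weighted and the padded part of the energy then each take half of the claimed bound.\<close>

lemma good_direction:
  assumes x: "feas x" and y: "feas y" and i: "0 < i" and gap: "8 * p * i < f x - f y"
  obtains \<Delta> where "direction_feasible p A b C x i \<Delta>" "energy x i \<Delta> \<le> i / (16 * p\<^sup>2)"
proof -
  define D where "D = x - y"
  define G where "G = grad x D"
  define H where "H = 8 * p * i"
  define t where "t = i / (2 * G)"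
  have xc: "x \<in> carrier_vec n" and yc: "y \<in> carrier_vec n"
    using x y by (auto simp: feasible_def)
  then have Dc: "D \<in> carrier_vec n" by (simp add: D_def)
  have "x - D = y" using xc yc by (intro eq_vecI) (auto simp: D_def)
  then have gap': "f x - f y \<le> G - p / 4 * wsq x D - 2 powr (1 - p) * npow D"
    using decrease_le[OF xc Dc] by (simp add: G_def)
  have nonneg: "0 \<le> p / 4 * wsq x D" "0 \<le> 2 powr (1 - p) * npow D"
    using p wsq_nonneg npow_nonneg by auto
  have H: "0 < H" using p i by (simp add: H_def)
  have G: "H < G" "0 < G" using gap gap' nonneg H unfolding H_def by linarith+
  have bounds: "p / 4 * wsq x D \<le> G - H" "2 powr (1 - p) * npow D \<le> G - H"
    using gap gap' nonneg unfolding H_def by linarith+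
  have t: "0 < t" using i G by (simp add: t_def)
  have "t \<le> i / (2 * H)" unfolding t_def using i G H by (intro divide_left_mono) auto
  also have "\<dots> = 1 / (16 * p)" using i by (simp add: H_def)
  finally have t_le: "t \<le> 1 / (16 * p)" .
  \<comment> \<open>(G - H) / G^2 is largest at G = 2 H.\<close>
  have "0 \<le> (G - 2 * H)\<^sup>2" by simp
  then have "4 * H * (G - H) \<le> G\<^sup>2" by (simp add: power2_eq_square algebra_simps)
  then have "(G - H) / G\<^sup>2 \<le> 1 / (4 * H)" using H G by (simp add: field_simps)
  then have "i\<^sup>2 / 4 * ((G - H) / G\<^sup>2) \<le> i\<^sup>2 / 4 * (1 / (4 * H))" by (intro mult_left_mono) auto
  also have "\<dots> = i / (128 * p)" using i p by (simp add: H_def power2_eq_square)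
  also have "i\<^sup>2 / 4 * ((G - H) / G\<^sup>2) = t\<^sup>2 * (G - H)" by (simp add: t_def power_divide power_mult_distrib)
  finally have tGH: "t\<^sup>2 * (G - H) \<le> i / (128 * p)" .
  define \<Delta> where "\<Delta> = t \<cdot>\<^sub>v D"
  have \<Delta>c: "\<Delta> \<in> carrier_vec n" using Dc by (simp add: \<Delta>_def)
  have "C *\<^sub>v \<Delta> = t \<cdot>\<^sub>v (d - d)"
    using xc yc x y Dc
    by (simp add: \<Delta>_def mult_mat_vec[OF C] D_def mult_minus_distrib_mat_vec[OF C] feasible_def del: index_mult_mat_vec)
  also have "\<dots> = 0\<^sub>v l" by (intro eq_vecI) auto
  finally have "direction_feasible p A b C x i \<Delta>"
    using \<Delta>c Dc G by (simp add: direction_feasible_iff[OF xc] \<Delta>_def grad_smult t_def flip: G_def)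
  moreover have "energy x i \<Delta> \<le> i / (16 * p\<^sup>2)"
  proof -
    have "wsq x \<Delta> = t\<^sup>2 * wsq x D" using Dc by (simp add: \<Delta>_def wsq_smult)
    also have "\<dots> \<le> t\<^sup>2 * (4 / p * (G - H))"
      using bounds(1) p by (intro mult_left_mono) (auto simp: field_simps)
    also have "\<dots> = 4 / p * (t\<^sup>2 * (G - H))" by simp
    also have "\<dots> \<le> 4 / p * (i / (128 * p))" using p tGH by (intro mult_left_mono) auto
    finally have w: "wsq x \<Delta> \<le> i / (32 * p\<^sup>2)" by (simp add: power2_eq_square)
    have "npow D \<le> 2 powr (p - 1) * (G - H)"
      using bounds(2) by (simp add: powr_diff field_simps)
    have "npow \<Delta> = t powr p * npow D" using Dc t by (simp add: \<Delta>_def npow_smult)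
    \<comment> \<open>Two factors t are spent on the bound for t^2 (G - H); the others use t <= 1 /
      (16 p).\<close>
    also have "\<dots> = t powr (p - 2) * (t\<^sup>2 * npow D)" using t by (simp add: powr_diff)
    also have "\<dots> \<le> (1 / (16 * p)) powr (p - 2) * (t\<^sup>2 * (2 powr (p - 1) * (G - H)))"
      using t t_le p npow_nonneg \<open>npow D \<le> _\<close>
      by (intro mult_mono powr_mono2 mult_left_mono) (auto)
    also have "\<dots> = (1 / (16 * p)) powr (p - 2) * 2 powr (p - 1) * (t\<^sup>2 * (G - H))" by simp
    also have "\<dots> \<le> (1 / (16 * p)) powr (p - 2) * 2 powr (p - 1) * (i / (128 * p))"
      using tGH by (intro mult_left_mono) auto
    also have "\<dots> = p * (1 / (16 * p) * 2) powr p * i"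
      using p unfolding powr_mult
      by (simp add: powr_diff power2_eq_square powr_divide powr_mult field_simps)
    \<comment> \<open>The stray factor p is at most 2^p, by the tangent of z^p at 1.\<close>
    also have "\<dots> \<le> 2 powr p * (1 / (16 * p) * 2) powr p * i"
      using i p powr_above_tangent[of p 2 1] by (intro mult_right_mono) auto
    also have "\<dots> = (2 * (1 / (16 * p) * 2)) powr p * i" by (simp only: powr_mult)
    also have "2 * (1 / (16 * p) * 2) = 1 / (4 * p)" by simp
    finally have "npow \<Delta> powr (2 / p) \<le> ((1 / (4 * p)) powr p * i) powr (2 / p)"
      using p npow_nonneg by (intro powr_mono2) auto
    also have "\<dots> = ((1 / (4 * p)) powr p) powr (2 / p) * i powr (2 / p)"
      by (rule powr_mult)
    also have "((1 / (4 * p)) powr p) powr (2 / p) = 1 / (16 * p\<^sup>2)"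
      using p by (simp add: powr_powr power2_eq_square power_divide)
    finally have np: "npow \<Delta> powr (2 / p) \<le> 1 / (16 * p\<^sup>2) * i powr (2 / p)" .
    have "padding p m i * nsq \<Delta> \<le> padding p m i * (real m powr ((p - 2) / p) * (1 / (16 * p\<^sup>2) * i powr (2 / p)))"
      by (intro mult_left_mono order_trans[OF nsq_powr_le] np padding_nonneg) auto
    also have "\<dots> = (real m powr (- ((p - 2) / p)) * real m powr ((p - 2) / p))
        * (i powr ((p - 2) / p) * i powr (2 / p)) / (32 * p\<^sup>2)"
      by (simp add: padding_def)
    also have "i powr ((p - 2) / p) * i powr (2 / p) = i"
      using i p by (simp flip: powr_add add_divide_distrib)
    \<comment> \<open>Only an inequality: for m = 0 the product of the two powers is 0, not
      1.\<close>
    also have "real m powr (- ((p - 2) / p)) * real m powr ((p - 2) / p) * i / (32 * p\<^sup>2) \<le> 1 * i / (32 * p\<^sup>2)"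
      using i by (intro divide_right_mono mult_right_mono) (auto simp flip: powr_add)
    finally have "padding p m i * nsq \<Delta> \<le> i / (32 * p\<^sup>2)" by simp
    then show ?thesis using w by (simp add: energy_def)
  qed
  ultimately show ?thesis by (rule that)
qed

(* k and alpha_0 of the algorithm; 16 lambda = 256 p. *)
definition ratio where
  "ratio x i \<Delta> = p powr p * npow \<Delta> / (2 * p\<^sup>2 * energy x i \<Delta>)"

definition test_step where
  "test_step x i \<Delta> = min (1 / (256 * p)) (1 / (256 * p * ratio x i \<Delta>) powr (1 / (p - 1)))"

lemma halving_test_iff:
  assumes "\<Delta> \<in> carrier_vec n"
  shows "halving_test p A b x i \<Delta> \<longleftrightarrow>
    residual p A b x (test_step x i \<Delta> \<cdot>\<^sub>v \<Delta>) < test_step x i \<Delta> / 4 * i \<or> 16 * i / p < energy x i \<Delta>"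
proof -
  have "16 * p * i / p\<^sup>2 = 16 * i / p" using p by (simp add: power2_eq_square)
  then show ?thesis
    using assms by (simp add: halving_test_def Let_def padded_energy_eq npow_eq test_step_def ratio_def mult_ac)
qed

text \<open>As the gradient along the direction is i / 2 > 0, some coordinate of its image under A
  is nonzero. This keeps the denominators in k and alpha_0 positive.\<close>

lemma direction_pos:
  assumes x: "x \<in> carrier_vec n" and i: "0 < i" and \<Delta>: "direction_feasible p A b C x i \<Delta>"
  shows "0 < real m" "0 < npow \<Delta>" "0 < energy x i \<Delta>" "0 < ratio x i \<Delta>" "0 < test_step x i \<Delta>"
proof -
  have "grad x \<Delta> \<noteq> 0" using \<Delta> i by (simp add: direction_feasible_iff[OF x])
  then obtain j where j: "j < m" "im \<Delta> j \<noteq> 0"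
    unfolding grad_def by (metis (mono_tags, lifting) sum.neutral mult_zero_right lessThan_iff)
  then show m: "0 < real m" by simp
  show np: "0 < npow \<Delta>"
    unfolding npow_def using j by (intro sum_pos2[of _ j]) auto
  have "0 < nsq \<Delta>"
    unfolding nsq_def using j by (intro sum_pos2[of _ j]) auto
  moreover have "0 < padding p m i" using m i by (simp add: padding_def)
  ultimately show e: "0 < energy x i \<Delta>"
    using wsq_nonneg[of x \<Delta>] by (simp add: energy_def add_nonneg_pos)
  show "0 < ratio x i \<Delta>" using np e p by (simp add: ratio_def)
  then show "0 < test_step x i \<Delta>" using p by (simp add: test_step_def)
qed

text \<open>The two arguments of the minimum in alpha_0 tame one loss each: a <= 1 / (256 p) the
  quadratic term, and a^(p-1) <= 1 / (256 p k) the p-th power term, which equals 2 p^2 E k by the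
  definition of k. Per unit of a, each loss is at most p E / 128 <= i / 128, so more than i / 4 of
  the gain i / 2 survives.\<close>

lemma no_halving:
  assumes x: "feas x" and y: "feas y" and i: "0 < i" and gap: "8 * p * i < f x - f y"
    and min: "is_arg_min (padded_energy p A b x i) (direction_feasible p A b C x i) \<Delta>"
  shows "\<not> halving_test p A b x i \<Delta>"
proof -
  have xc: "x \<in> carrier_vec n" using x by (simp add: feasible_def)
  have df: "direction_feasible p A b C x i \<Delta>" using min by (simp add: is_arg_min_def)
  then have \<Delta>c: "\<Delta> \<in> carrier_vec n" and g: "grad x \<Delta> = i / 2"
    by (auto simp: direction_feasible_iff[OF xc])
  obtain \<Delta>' where \<Delta>': "direction_feasible p A b C x i \<Delta>'" "energy x i \<Delta>' \<le> i / (16 * p\<^sup>2)"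
    using good_direction[OF x y i gap] by blast
  then have "\<Delta>' \<in> carrier_vec n" by (auto simp: direction_feasible_iff[OF xc])
  then have "energy x i \<Delta> \<le> energy x i \<Delta>'"
    using min \<Delta>' \<Delta>c by (auto simp: is_arg_min_linorder padded_energy_eq)
  then have E: "energy x i \<Delta> \<le> i / (16 * p\<^sup>2)" using \<Delta>' by simp
  define a where "a = test_step x i \<Delta>"
  define k where "k = ratio x i \<Delta>"
  define E' where "E' = energy x i \<Delta>"
  note pos = direction_pos[OF xc i df, folded a_def k_def E'_def]
  have a1: "a \<le> 1 / (256 * p)" by (simp add: a_def test_step_def)
  have a2: "a powr (p - 1) \<le> 1 / (256 * p * k)"
  proof -
    have "a powr (p - 1) \<le> (1 / (256 * p * k) powr (1 / (p - 1))) powr (p - 1)"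
      using pos p by (intro powr_mono2) (auto simp: a_def k_def test_step_def)
    also have "\<dots> = 1 / (256 * p * k)"
      using pos p by (simp add: powr_divide powr_powr)
    finally show ?thesis .
  qed
  have pn: "p powr p * npow \<Delta> = 2 * p\<^sup>2 * E' * k"
    using pos p by (simp add: k_def ratio_def E'_def)
  have "wsq x \<Delta> \<le> E'"
    using padding_nonneg nsq_nonneg by (simp add: E'_def energy_def)
  then have "2 * p\<^sup>2 * a * wsq x \<Delta> \<le> 2 * p\<^sup>2 * (1 / (256 * p)) * E'"
    using a1 p pos wsq_nonneg by (intro mult_mono) auto
  then have w: "2 * p\<^sup>2 * a * wsq x \<Delta> \<le> p * E' / 128" using p by (simp add: power2_eq_square)
  have "a powr (p - 1) * (p powr p * npow \<Delta>) \<le> 1 / (256 * p * k) * (2 * p\<^sup>2 * E' * k)"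
    unfolding pn using a2 pos by (intro mult_right_mono) auto
  then have n: "a powr (p - 1) * (p powr p * npow \<Delta>) \<le> p * E' / 128"
    using p pos by (simp add: power2_eq_square mult_ac)
  have "p * E' \<le> p * (i / (16 * p\<^sup>2))" using E p by (intro mult_left_mono) (auto simp: E'_def)
  also have "\<dots> = i / (16 * p)" using p by (simp add: power2_eq_square)
  also have "\<dots> \<le> i / 1" using p i by (intro divide_left_mono) auto
  finally have "p * E' \<le> i" by simp
  have "a * (i / 4) \<le> a * (i / 2 - 2 * p\<^sup>2 * a * wsq x \<Delta> - a powr (p - 1) * (p powr p * npow \<Delta>))"
  proof (rule mult_left_mono)
    have "p * E' / 128 \<le> i / 128" using \<open>p * E' \<le> i\<close> by simp
    then show "i / 4 \<le> i / 2 - 2 * p\<^sup>2 * a * wsq x \<Delta> - a powr (p - 1) * (p powr p * npow \<Delta>)"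
      using w n i by linarith
  qed (use pos in simp)
  also have "\<dots> = a * (i/2) - 2 * p\<^sup>2 * (a\<^sup>2 * wsq x \<Delta>) - p powr p * (a powr p * npow \<Delta>)"
  proof -
    have "a powr p = a * a powr (p - 1)" using pos by (simp add: powr_diff)
    then show ?thesis by (simp add: power2_eq_square algebra_simps)
  qed
  also have "\<dots> = residual p A b x (a \<cdot>\<^sub>v \<Delta>)"
    using pos \<Delta>c by (simp add: residual_eq[OF xc] grad_smult wsq_smult npow_smult g)
  finally have "a / 4 * i \<le> residual p A b x (a \<cdot>\<^sub>v \<Delta>)" by simp
  moreover have "E' \<le> 16 * i / p"
  proof -
    have "p * E' \<le> 16 * i" using \<open>p * E' \<le> i\<close> i by simp
    then show ?thesis using p by (simp add: field_simps)
  qed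
  ultimately show ?thesis by (simp add: halving_test_iff[OF \<Delta>c] a_def E'_def)
qed

lemma M_ge_one: "0 < real m \<Longrightarrow> 1 \<le> M"
  using p by (auto simp: M_def intro!: ge_one_powr_ge_zero)

lemma M_nonneg: "0 \<le> M"
  by (simp add: M_def)

text \<open>Here the padding pays off: \<open>npow\<close> is at most nsq^(p/2), hence at most (E /
  s)^(p/2). One factor E cancels in k, the other (p-2)/2 are bounded through E <= 16 i / p, and the
  powers of i cancel since s is half of (i / m)^((p-2)/p).\<close>

lemma ratio_le:
  assumes x: "x \<in> carrier_vec n" and i: "0 < i" and \<Delta>: "direction_feasible p A b C x i \<Delta>"
    and E: "energy x i \<Delta> \<le> 16 * i / p"
  shows "ratio x i \<Delta> \<le> (32 * p * m) powr ((p - 2) / 2)"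
proof -
  define q where "q = (p - 2) / 2"
  define e where "e = energy x i \<Delta>"
  note pos = direction_pos[OF x i \<Delta>, folded e_def]
  define s where "s = padding p m i"
  define X where "X = i / m"
  have "0 < X" using i pos by (simp add: X_def)
  have s: "s = 1 / 2 * X powr ((p - 2) / p)"
    using i pos by (simp add: s_def padding_def X_def powr_divide powr_minus field_simps)
  have "0 < s" using \<open>0 < X\<close> by (simp add: s)
  have "s * nsq \<Delta> \<le> e" using wsq_nonneg by (simp add: e_def energy_def s_def)
  have "s powr (p/2) * npow \<Delta> \<le> s powr (p/2) * nsq \<Delta> powr (p/2)"
    by (intro mult_left_mono npow_le_nsq_powr) auto
  also have "\<dots> = (s * nsq \<Delta>) powr (p/2)"
    using \<open>0 < s\<close> nsq_nonneg by (simp add: powr_mult)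
  also have "\<dots> \<le> e powr (p/2)"
    using \<open>s * nsq \<Delta> \<le> e\<close> \<open>0 < s\<close> nsq_nonneg p by (intro powr_mono2) auto
  also have "\<dots> = e * e powr q" using pos by (simp add: q_def diff_divide_distrib powr_diff)
  also have "\<dots> \<le> e * (16 * i / p) powr q"
    using E pos p by (intro mult_left_mono powr_mono2) (auto simp: q_def e_def)
  finally have 1: "s powr (p/2) * npow \<Delta> \<le> e * (16 * i / p) powr q" .
  have s': "s powr (p/2) = (1/2) powr (p/2) * X powr q"
    unfolding s using \<open>0 < X\<close> p by (subst powr_mult) (auto simp: powr_powr q_def)
  have c: "(1/2) powr (p/2) * (2 * 2 powr q) = (1::real)"
    by (simp add: q_def diff_divide_distrib powr_diff powr_divide)
  have "16 * i / p = 16 * m / p * X" using pos by (simp add: X_def)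
  then have "(16 * i / p) powr q = (16 * m / p) powr q * X powr q"
    using p \<open>0 < X\<close> by (simp only: powr_mult)
  then have "(1/2) powr (p/2) * X powr q * npow \<Delta> \<le> e * (16 * m / p) powr q * X powr q"
    using 1 unfolding s' by simp
  then have "(1/2) powr (p/2) * npow \<Delta> \<le> e * (16 * m / p) powr q"
    using \<open>0 < X\<close> by (simp add: mult_ac)
  then have "(1/2) powr (p/2) * npow \<Delta> * (2 * 2 powr q) \<le> e * (16 * m / p) powr q * (2 * 2 powr q)"
    by (intro mult_right_mono) auto
  then have "npow \<Delta> * ((1/2) powr (p/2) * (2 * 2 powr q)) \<le> 2 * e * (2 powr q * (16 * m / p) powr q)"
    by (simp add: mult_ac)
  also have "2 powr q * (16 * m / p) powr q = (32 * m / p) powr q"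
    using p by (simp flip: powr_mult)
  finally have "npow \<Delta> \<le> 2 * e * (32 * m / p) powr q" unfolding c by simp
  have pp: "p powr p = p\<^sup>2 * (p\<^sup>2) powr q"
    using p powr_sq_half[of p "p - 2"] by (simp add: q_def powr_diff)
  have "p powr p * npow \<Delta> \<le> p powr p * (2 * e * (32 * m / p) powr q)"
    using \<open>npow \<Delta> \<le> _\<close> by (intro mult_left_mono) auto
  also have "p powr p * (2 * e * (32 * m / p) powr q) = 2 * p\<^sup>2 * e * ((p\<^sup>2) powr q * (32 * m / p) powr q)"
    by (simp add: pp)
  also have "(p\<^sup>2) powr q * (32 * m / p) powr q = (p\<^sup>2 * (32 * m / p)) powr q"
    by (rule powr_mult[symmetric])
  also have "p\<^sup>2 * (32 * m / p) = 32 * p * m" using p by (simp add: power2_eq_square)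
  finally show ?thesis
    unfolding ratio_def using p pos by (simp add: field_simps flip: q_def e_def)
qed

lemma test_step_ge:
  assumes x: "x \<in> carrier_vec n" and i: "0 < i" and \<Delta>: "direction_feasible p A b C x i \<Delta>"
    and E: "energy x i \<Delta> \<le> 16 * i / p"
  shows "1 / (256 * p * M) \<le> test_step x i \<Delta>"
proof -
  define q where "q = (p - 2) / 2"
  define k where "k = ratio x i \<Delta>"
  note pos = direction_pos[OF x i \<Delta>, folded k_def]
  have M: "1 \<le> M" using M_ge_one pos by simp
  \<comment> \<open>Generous on purpose: with exponent p - 2, the extra factor 256 p completes a
    full (p-1)-th power, whose root is 256 p M.\<close>
  have "(32 * p) powr q \<le> (256 * p) powr q"
    using p by (intro powr_mono2) (auto simp: q_def)
  also have "\<dots> \<le> (256 * p) powr (p - 2)"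
    using p by (intro powr_mono) (auto simp: q_def)
  finally have base: "(32 * p) powr q \<le> (256 * p) powr (p - 2)" .
  have Mq: "M powr (p - 1) = real m powr q"
  proof -
    have "(p - 2) / (2 * (p - 1)) * (p - 1) = q" using p by (simp add: q_def field_simps)
    then show ?thesis by (simp only: M_def powr_powr)
  qed
  have "256 * p * k \<le> 256 * p * (32 * p * m) powr q"
    using ratio_le[OF assms] p by (intro mult_left_mono) (auto simp: q_def k_def)
  also have "\<dots> = 256 * p * ((32 * p) powr q * real m powr q)" using p by (simp add: powr_mult)
  also have "\<dots> \<le> 256 * p * ((256 * p) powr (p - 2) * real m powr q)"
    using base p by (intro mult_left_mono mult_right_mono) auto
  also have "\<dots> = (256 * p) powr (p - 1) * M powr (p - 1)"
  proof -
    have "(256 * p) powr (p - 1) = 256 * p * (256 * p) powr (p - 2)"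
      using p powr_add[of "256 * p" 1 "p - 2"] by simp
    then show ?thesis unfolding Mq by simp
  qed
  also have "\<dots> = (256 * p * M) powr (p - 1)"
    using p M by (simp add: powr_mult)
  finally have "(256 * p * k) powr (1 / (p - 1)) \<le> ((256 * p * M) powr (p - 1)) powr (1 / (p - 1))"
    using p pos by (intro powr_mono2) auto
  also have "\<dots> = 256 * p * M" using p M by (simp add: powr_powr)
  finally have "1 / (256 * p * M) \<le> 1 / (256 * p * k) powr (1 / (p - 1))"
    using p pos M by (intro divide_left_mono) auto
  moreover have "1 / (256 * p * M) \<le> 1 / (256 * p)"
    using p M by (intro divide_left_mono) auto
  ultimately show ?thesis by (simp add: test_step_def k_def)
qed

text \<open>A halving is allowed only when the gap is at most 8 p i, which is 16 p times the new i.
  Otherwise the test guarantees alpha_0 i / 4 with alpha_0 >= 1 / (256 p M), whence 1024 = 4 * 256,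
  and the line search does at least as well.\<close>

lemma step_progress:
  assumes step: "irls_step p A b C x i x' i'" and x: "feas x" and i: "0 < i"
    and inv: "\<forall>y. feas y \<longrightarrow> f x - f y \<le> 16 * p * i"
  shows "feas x'" "f x' \<le> f x" "\<And>y. feas y \<Longrightarrow> f x' - f y \<le> 16 * p * i'"
    "i' = i / 2 \<or> i' = i \<and> f x' \<le> f x - i / (1024 * p * M)"
proof -
  have xc: "x \<in> carrier_vec n" using x by (simp add: feasible_def)
  have "feas x' \<and> f x' \<le> f x \<and> (\<forall>y. feas y \<longrightarrow> f x' - f y \<le> 16 * p * i')
    \<and> (i' = i / 2 \<or> i' = i \<and> f x' \<le> f x - i / (1024 * p * M))"
    using step
  proof cases
    case (move \<Delta> \<alpha>)
    have df: "direction_feasible p A b C x i \<Delta>" using move by (simp add: is_arg_min_def)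
    then have \<Delta>c: "\<Delta> \<in> carrier_vec n" and \<Delta>C: "C *\<^sub>v \<Delta> = 0\<^sub>v l"
      by (auto simp: direction_feasible_iff[OF xc])
    have ls: "f x' \<le> f (x - a \<cdot>\<^sub>v \<Delta>)" for a
      using move by (auto simp: is_arg_min_linorder)
    have "f (x - 0 \<cdot>\<^sub>v \<Delta>) = f x"
      using objective_move[OF xc \<Delta>c, of 0] by (simp add: objective_eq)
    then have le: "f x' \<le> f x" using ls[of 0] by simp
    have "feas x'" using feas_move[OF x \<Delta>c \<Delta>C] move by simp
    moreover have "\<forall>y. feas y \<longrightarrow> f x' - f y \<le> 16 * p * i'"
    proof (intro allI impI)
      fix y assume y: "feas y"
      show "f x' - f y \<le> 16 * p * i'"
      proof (cases "halving_test p A b x i \<Delta>")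
        case True
        then have "\<not> 8 * p * i < f x - f y" using no_halving[OF x y i] move by blast
        moreover have "16 * p * i' = 8 * p * i" using True move by simp
        ultimately show ?thesis using le by linarith
      next
        case False
        then have "i' = i" using move by simp
        moreover have "f x - f y \<le> 16 * p * i" using inv y by blast
        ultimately show ?thesis using le by simp
      qed
    qed
    moreover have "i' = i / 2 \<or> i' = i \<and> f x' \<le> f x - i / (1024 * p * M)"
    proof (cases "halving_test p A b x i \<Delta>")
      case False
      then have res: "test_step x i \<Delta> / 4 * i \<le> residual p A b x (test_step x i \<Delta> \<cdot>\<^sub>v \<Delta>)"
        and E: "energy x i \<Delta> \<le> 16 * i / p"
        by (auto simp: halving_test_iff[OF \<Delta>c])
      have "i / (1024 * p * M) = 1 / (256 * p * M) / 4 * i" by simp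
      also have "\<dots> \<le> test_step x i \<Delta> / 4 * i"
        using test_step_ge[OF xc i df E] i by (intro mult_right_mono divide_right_mono) auto
      also have "\<dots> \<le> f x - f (x - test_step x i \<Delta> \<cdot>\<^sub>v \<Delta>)"
        using res decrease_ge_residual[OF xc, of "test_step x i \<Delta> \<cdot>\<^sub>v \<Delta>"] \<Delta>c by simp
      finally show ?thesis using ls[of "test_step x i \<Delta>"] False move by simp
    qed (use move in simp)
    ultimately show ?thesis using le by blast
  next
    case stay
    \<comment> \<open>A larger gap would supply a feasible direction.\<close>
    have "f x - f y \<le> 8 * p * i" if "feas y" for y
      using good_direction[OF x that i] stay by (metis not_le)
    moreover have "16 * p * i' = 8 * p * i" using stay by simp
    ultimately have "\<forall>y. feas y \<longrightarrow> f x - f y \<le> 16 * p * i'" by metis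
    moreover have "x' = x" "i' = i / 2" using stay by simp_all
    ultimately show ?thesis using x by blast
  qed
  then show "feas x'" "f x' \<le> f x" "\<And>y. feas y \<Longrightarrow> f x' - f y \<le> 16 * p * i'"
    "i' = i / 2 \<or> i' = i \<and> f x' \<le> f x - i / (1024 * p * M)" by auto
qed

subsection \<open>Counting iterations\<close>

text \<open>An infimum, so that the count can refer to the optimal value without choosing a
  minimiser.\<close>

definition OPT :: real where "OPT = (INF y\<in>{y. feas y}. f y)"

lemma OPT_le: "feas y \<Longrightarrow> OPT \<le> f y"
  unfolding OPT_def using objective_nonneg by (intro cINF_lower bdd_belowI2[where m = 0]) auto

lemma le_OPT: "feas x \<Longrightarrow> (\<And>y. feas y \<Longrightarrow> c \<le> f y) \<Longrightarrow> c \<le> OPT"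
  unfolding OPT_def by (intro cINF_greatest) auto

text \<open>Pass from the p-norm to the 2-norm at x, use its minimality there, and return to the
  p-norm at y; only the return costs a power of m.\<close>

lemma least_squares_objective_le:
  assumes "is_arg_min (\<lambda>x. (pnorm 2 (A *\<^sub>v x - b))\<^sup>2) (feasible (dim_col A) C d) x"
  shows "f x \<le> real m powr ((p - 2) / 2) * OPT"
proof -
  have x: "feas x" using assms by (simp add: is_arg_min_def)
  have le: "f x \<le> real m powr ((p - 2) / 2) * f y" if "feas y" for y
  proof -
    have "f x \<le> (\<Sum>j<m. (rs x j)\<^sup>2) powr (p / 2)"
      unfolding objective_eq by (rule sum_powr_le_powr_sum[OF p])
    also have "\<dots> \<le> (\<Sum>j<m. (rs y j)\<^sup>2) powr (p / 2)"
      using assms that p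
      by (intro powr_mono2) (auto simp: is_arg_min_linorder pnorm_two_sq intro!: sum_nonneg)
    also have "\<dots> \<le> real m powr ((p - 2) / 2) * f y"
      unfolding objective_eq by (rule powr_sum_le_sum_powr[OF p])
    finally show ?thesis .
  qed
  show ?thesis
  proof (cases "m = 0")
    case True
    then show ?thesis by (simp add: objective_eq)
  next
    case False
    then have "f x / real m powr ((p - 2) / 2) \<le> OPT"
      using le by (intro le_OPT[OF x]) (simp add: field_simps)
    then show ?thesis using False by (simp add: field_simps)
  qed
qed

text \<open>The largest admissible gap 16 p i divided by the guaranteed decrease i / (1024 p
  M).\<close>

definition phase_length :: real where "phase_length = 16384 * p\<^sup>2 * M"

lemma guard_pos:
  assumes "0 < \<epsilon>" "loop_guard p \<epsilon> A b x i"
  shows "0 < i"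
proof -
  have "0 \<le> \<epsilon> / (16 * p * (1 + \<epsilon>)) * f x" using assms(1) p objective_nonneg by simp
  then show ?thesis using assms(2) by (simp add: loop_guard_def)
qed

(* h counts the halvings; within a phase the remaining gap, measured in guaranteed decreases,
   is the potential. *)
lemma run_invariant:
  assumes eps: "0 < \<epsilon>" and "irls_run p \<epsilon> A b C d N x i"
  shows "feas x \<and> (\<forall>y. feas y \<longrightarrow> f x - f y \<le> 16 * p * i) \<and>
    (0 < N \<longrightarrow> 0 < i \<and> \<epsilon> / (16 * p * (1 + \<epsilon>)) * OPT < 2 * i) \<and>
    (\<exists>h::nat. i * 2 ^ h * (16 * p) \<le> real m powr ((p - 2) / 2) * OPT \<and>
      real N \<le> (phase_length + 1) * h + phase_length - (f x - OPT) * (1024 * p * M) / i)"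
  using assms(2)
proof induction
  case (init x)
  have x: "feas x" using init by (simp add: is_arg_min_def)
  have i: "16 * p * (f x / (16 * p)) = f x" using p by simp
  have "0 \<le> phase_length - (f x - OPT) * (1024 * p * M) / (f x / (16 * p))"
  \<comment> \<open>If f x = 0 then i = 0 and the quotient is 0 by convention; otherwise OPT >= 0
    bounds the gap by f x = 16 p i.\<close>
  proof (cases "f x = 0")
    case True
    then show ?thesis using M_nonneg by (simp add: phase_length_def)
  next
    case False
    then have "0 < f x" using objective_nonneg[of x] by simp
    have "0 \<le> OPT" using objective_nonneg by (intro le_OPT[OF x])
    then have "(f x - OPT) * (1024 * p * M) / (f x / (16 * p)) \<le> f x * (1024 * p * M) / (f x / (16 * p))"
      using p M_nonneg \<open>0 < f x\<close> by (intro divide_right_mono mult_right_mono) auto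
    also have "\<dots> = phase_length" using \<open>0 < f x\<close> p by (simp add: phase_length_def power2_eq_square)
    finally show ?thesis by simp
  qed
  then show ?case
    using x least_squares_objective_le[OF init] objective_nonneg p
    by (auto simp: i intro!: exI[of _ 0])
next
  case (iterate N x i x' i')
  then obtain h :: nat where x: "feas x" and inv: "\<forall>y. feas y \<longrightarrow> f x - f y \<le> 16 * p * i"
    and h: "i * 2 ^ h * (16 * p) \<le> real m powr ((p - 2) / 2) * OPT"
    and count: "real N \<le> (phase_length + 1) * h + phase_length - (f x - OPT) * (1024 * p * M) / i"
    by blast
  have i: "0 < i" using guard_pos[OF eps] iterate by blast
  note step = step_progress[OF \<open>irls_step p A b C x i x' i'\<close> x i inv]
  have "0 < i * 2 ^ h * (16 * p)" using i p by simp
  then have "real m powr ((p - 2) / 2) * OPT > 0" using h by linarith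
  then have "0 < real m" by (cases "m = 0") auto
  then have M: "1 \<le> M" by (rule M_ge_one)
  have i': "0 < i'" "i \<le> 2 * i'" using step(4) i by auto
  have "\<epsilon> / (16 * p * (1 + \<epsilon>)) * OPT \<le> \<epsilon> / (16 * p * (1 + \<epsilon>)) * f x"
    using eps p OPT_le[OF x] by (intro mult_left_mono) auto
  also have "\<dots> < i" using iterate by (simp add: loop_guard_def)
  \<comment> \<open>The guard held for the old i, which the pass has at most halved; hence the
    factor 2.\<close>
  finally have lower: "\<epsilon> / (16 * p * (1 + \<epsilon>)) * OPT < 2 * i'" using i' by simp
  have "\<exists>h::nat. i' * 2 ^ h * (16 * p) \<le> real m powr ((p - 2) / 2) * OPT \<and>
      real (Suc N) \<le> (phase_length + 1) * h + phase_length - (f x' - OPT) * (1024 * p * M) / i'"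
    using step(4)
  proof (elim disjE conjE)
    assume half: "i' = i / 2"
    \<comment> \<open>A halving resets the potential to at most a full phase; the pass itself
      accounts for the 1 in \<open>phase_length + 1\<close>.\<close>
    have "f x' - 16 * p * i' \<le> OPT"
      using step(3) by (intro le_OPT[OF x]) (simp add: algebra_simps)
    then have "(f x' - OPT) * (1024 * p * M) / i' \<le> 16 * p * i' * (1024 * p * M) / i'"
      using i' p M by (intro divide_right_mono mult_right_mono) auto
    also have "\<dots> = phase_length" using i' by (simp add: phase_length_def power2_eq_square)
    finally have "(f x' - OPT) * (1024 * p * M) / i' \<le> phase_length" .
    moreover have "0 \<le> (f x - OPT) * (1024 * p * M) / i"
      using i p M OPT_le[OF x] by simp
    ultimately have "real (Suc N) \<le> (phase_length + 1) * Suc h + phase_length - (f x' - OPT) * (1024 * p * M) / i'"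
      using count by (simp add: algebra_simps)
    moreover have "i' * 2 ^ Suc h = i * 2 ^ h" using half by simp
    then have "i' * 2 ^ Suc h * (16 * p) \<le> real m powr ((p - 2) / 2) * OPT"
      using h by (simp only:)
    ultimately show ?thesis by blast
  next
    assume keep: "i' = i" and dec: "f x' \<le> f x - i / (1024 * p * M)"
    \<comment> \<open>One guaranteed decrease lowers the potential by 1, which pays for the
      pass.\<close>
    have "(f x' - OPT) * (1024 * p * M) / i \<le> (f x - i / (1024 * p * M) - OPT) * (1024 * p * M) / i"
      using i p M dec by (intro divide_right_mono mult_right_mono) auto
    also have "\<dots> = (f x - OPT) * (1024 * p * M) / i - 1"
      using i p M by (simp add: field_simps)
    finally have "real (Suc N) \<le> (phase_length + 1) * h + phase_length - (f x' - OPT) * (1024 * p * M) / i'"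
      using count keep by simp
    then show ?thesis using h keep by blast
  qed
  then show ?case using step(1,3) i' lower by blast
qed

text \<open>The guard bounds i from below and the h halvings bound it from above, so 2^h <= 4
  m^((p-2)/2) / e and h + 1 <= 3 p L. With at most 16385 p^2 M passes per halving the constant is 3
  * 16385 = 49155, rounded up.\<close>

lemma run_bound:
  assumes eps: "0 < \<epsilon>" and run: "irls_run p \<epsilon> A b C d N x i"
  shows "real N \<le> 50000 * iteration_bound p m \<epsilon>"
proof (cases "N = 0")
  case True
  then show ?thesis by (simp add: iteration_bound_def)
next
  case False
  define e where "e = min 1 \<epsilon>"
  define L where "L = max 1 (ln (real m / e))"
  obtain h :: nat where x: "feas x" and i: "0 < i" and lower: "\<epsilon> / (16 * p * (1 + \<epsilon>)) * OPT < 2 * i"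
    and h: "i * 2 ^ h * (16 * p) \<le> real m powr ((p - 2) / 2) * OPT"
    and count: "real N \<le> (phase_length + 1) * h + phase_length - (f x - OPT) * (1024 * p * M) / i"
    using run_invariant[OF eps run] False by blast
  have "0 < i * 2 ^ h * (16 * p)" using i p by simp
  then have pos: "real m powr ((p - 2) / 2) * OPT > 0" using h by linarith
  then have m: "1 \<le> real m" by (cases "m = 0") auto
  then have M: "1 \<le> M" by (intro M_ge_one) auto
  have OPT: "0 < OPT" using pos m by (simp add: zero_less_mult_iff)
  have e: "0 < e" "e \<le> 1" using eps by (auto simp: e_def)
  have "\<epsilon> / (1 + \<epsilon>) * OPT = \<epsilon> / (16 * p * (1 + \<epsilon>)) * OPT * (16 * p)" using p by simp
  also have "\<dots> \<le> 2 * i * (16 * p)" using lower p by (intro mult_right_mono) auto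
  finally have "\<epsilon> / (1 + \<epsilon>) * OPT * 2 ^ h \<le> 2 * i * (16 * p) * 2 ^ h"
    by (intro mult_right_mono) auto
  also have "\<dots> = 2 * (i * 2 ^ h * (16 * p))" by simp
  also have "\<dots> \<le> 2 * (real m powr ((p - 2) / 2) * OPT)" using h by linarith
  finally have "OPT * (\<epsilon> / (1 + \<epsilon>) * 2 ^ h) \<le> OPT * (2 * real m powr ((p - 2) / 2))"
    by (simp add: mult_ac)
  then have "\<epsilon> / (1 + \<epsilon>) * 2 ^ h \<le> 2 * real m powr ((p - 2) / 2)"
    using OPT by (rule mult_left_le_imp_le)
  moreover have "e / 2 \<le> \<epsilon> / (1 + \<epsilon>)"
    using eps by (cases "\<epsilon> \<le> 1") (auto simp: e_def field_simps min_def)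
  then have "e / 2 * 2 ^ h \<le> \<epsilon> / (1 + \<epsilon>) * 2 ^ h" by (intro mult_right_mono) auto
  ultimately have "e / 2 * 2 ^ h \<le> 2 * real m powr ((p - 2) / 2)" by linarith
  then have "2 ^ h \<le> 4 * real m powr ((p - 2) / 2) / e" using e by (simp add: field_simps)
  then have "ln (2 ^ h) \<le> ln (4 * real m powr ((p - 2) / 2) / e)" using m e by (intro ln_mono) auto
  also have "\<dots> = 2 * ln 2 + (p - 2) / 2 * ln m - ln e"
    using m e ln_realpow[of 2 2] by (simp add: ln_div ln_mult ln_powr)
  finally have h1: "h * ln 2 \<le> 2 * ln 2 + (p - 2) / 2 * ln m - ln e"
    by (simp add: ln_realpow)
  have "ln (real m / e) = ln m - ln e" using m e by (simp add: ln_div)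
  moreover have "ln e \<le> 0" "0 \<le> ln m" using e m by auto
  ultimately have L: "1 \<le> L" "ln m \<le> L" "- ln e \<le> L" by (auto simp: L_def)
  have "(p - 2) / 2 * ln m \<le> (p - 2) / 2 * L" using p L by (intro mult_left_mono) auto
  \<comment> \<open>The spare \<open>- L\<close> absorbs \<open>- ln e\<close>, so h stays linear in
    p L with coefficient 1.\<close>
  moreover have "(p - 2) / 2 * L = p * L / 2 - L" by (simp add: field_simps)
  ultimately have "h * ln 2 \<le> 2 * ln 2 + p * L / 2" using h1 L(3) by linarith
  moreover have ln2: "1 / 2 \<le> ln (2::real)" using ln_le_minus_one[of "1/2 :: real"] by (simp add: ln_div)
  have "p * L * (1 / 2) \<le> p * L * ln 2" using p L ln2 by (intro mult_left_mono) auto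
  ultimately have "h * ln 2 \<le> (2 + p * L) * ln 2" by (simp add: algebra_simps)
  then have "real h \<le> 2 + p * L" using ln2 by simp
  moreover have "2 * 1 \<le> p * L" using p L by (intro mult_mono) auto
  ultimately have h3: "real h + 1 \<le> 3 * (p * L)" by simp
  have "1 * 1 \<le> p\<^sup>2 * M" using p M by (intro mult_mono) (auto simp: one_le_power)
  then have ph: "phase_length + 1 \<le> 16385 * (p\<^sup>2 * M)" by (simp add: phase_length_def mult_ac)
  have "0 \<le> (f x - OPT) * (1024 * p * M) / i" using i p M OPT_le[OF x] by simp
  then have "real N \<le> (phase_length + 1) * (real h + 1)" using count by (simp add: algebra_simps)
  also have "\<dots> \<le> 16385 * (p\<^sup>2 * M) * (3 * (p * L))"
    using ph h3 M by (intro mult_mono) auto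
  also have "\<dots> = 49155 * (p ^ 3 * M * L)" by (simp add: power3_eq_cube power2_eq_square)
  also have "\<dots> \<le> 50000 * (p powr (7/2) * M * L)"
  proof -
    \<comment> \<open>The count has p^3; since p >= 1 it is below the stated power 7/2.\<close>
    have "p ^ 3 = p powr 3" using p by simp
    also have "\<dots> \<le> p powr (7/2)" using p by (intro powr_mono) auto
    finally show ?thesis using p M L by (intro mult_mono) auto
  qed
  finally show ?thesis by (simp add: iteration_bound_def M_def L_def e_def)
qed

text \<open>At exit, 16 p i is at most the fraction \<epsilon> / (1 + \<epsilon>) of f x, so f x /
  (1 + \<epsilon>) is a lower bound for every feasible value.\<close>

lemma returns_approx:
  assumes eps: "0 < \<epsilon>" and run: "irls_run p \<epsilon> A b C d N x i"
    and stop: "\<not> loop_guard p \<epsilon> A b x i" and y: "feas y"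
  shows "f x \<le> (1 + \<epsilon>) * f y"
proof -
  have "f x - f y \<le> 16 * p * i" using run_invariant[OF eps run] y by blast
  also have "\<dots> \<le> 16 * p * (\<epsilon> / (16 * p * (1 + \<epsilon>)) * f x)"
    using stop p by (intro mult_left_mono) (auto simp: loop_guard_def)
  also have "\<dots> = \<epsilon> / (1 + \<epsilon>) * f x" using p by simp
  finally have "(f x - f y) * (1 + \<epsilon>) \<le> \<epsilon> / (1 + \<epsilon>) * f x * (1 + \<epsilon>)"
    using eps by (intro mult_right_mono) auto
  also have "\<dots> = \<epsilon> * f x" using eps by simp
  finally show ?thesis by (simp add: algebra_simps)
qed

end

text \<open>A run exists, every run is short, and none is stuck while the guard holds: together this
  is termination for every choice of minimisers.\<close>

theorem theorem1:
  shows "\<exists>K > 0. \<forall>p \<epsilon> m n l A b C d.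
    2 \<le> p \<and> 0 < \<epsilon> \<and>
    A \<in> carrier_mat m n \<and> b \<in> carrier_vec m \<and>
    C \<in> carrier_mat l n \<and> d \<in> carrier_vec l \<and> (\<exists>x. feasible n C d x) \<longrightarrow>
    (\<exists>x i. irls_run p \<epsilon> A b C d 0 x i) \<and>
    (\<forall>N x i. irls_run p \<epsilon> A b C d N x i \<longrightarrow>
       real N \<le> K * iteration_bound p m \<epsilon> \<and>
       (loop_guard p \<epsilon> A b x i \<longrightarrow> (\<exists>x' i'. irls_step p A b C x i x' i'))) \<and>
    (\<forall>x. irls_returns p \<epsilon> A b C d x \<longrightarrow>
       x \<in> carrier_vec n \<and> C *\<^sub>v x = d \<and>
       (\<forall>xstar. is_arg_min (objective p A b) (feasible n C d) xstar \<longrightarrow>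
          pnorm p (A *\<^sub>v x - b) powr p \<le> (1 + \<epsilon>) * pnorm p (A *\<^sub>v xstar - b) powr p))"
proof (intro exI[of _ "50000::real"] conjI allI impI; (elim conjE)?)
  show "(0::real) < 50000" by simp
next
  fix p \<epsilon> :: real and m n l :: nat and A C :: "real mat" and b d :: "real vec"
  assume "2 \<le> p" and eps: "0 < \<epsilon>" and "A \<in> carrier_mat m n" "b \<in> carrier_vec m"
    "C \<in> carrier_mat l n" "d \<in> carrier_vec l" and nonempty: "\<exists>x. feasible n C d x"
  then interpret irls p A b C d m n l by unfold_locales
  show "\<exists>x i. irls_run p \<epsilon> A b C d 0 x i"
    using least_squares_exists[OF nonempty] irls_run.init by metis
  fix x
  {
    fix N i assume run: "irls_run p \<epsilon> A b C d N x i"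
    then show "real N \<le> 50000 * iteration_bound p m \<epsilon>" by (rule run_bound[OF eps])
    have "x \<in> carrier_vec n" using run_invariant[OF eps run] by (simp add: feasible_def)
    then show "\<exists>x' i'. irls_step p A b C x i x' i'" using step_exists by metis
  }
  assume "irls_returns p \<epsilon> A b C d x"
  then obtain N i where run: "irls_run p \<epsilon> A b C d N x i" and stop: "\<not> loop_guard p \<epsilon> A b x i"
    by (auto simp: irls_returns_def)
  show "x \<in> carrier_vec n" "C *\<^sub>v x = d"
    using run_invariant[OF eps run] by (simp_all add: feasible_def)
  fix xstar assume "is_arg_min (objective p A b) (feasible n C d) xstar"
  then have "feas xstar" by (simp add: is_arg_min_def)
  then show "pnorm p (A *\<^sub>v x - b) powr p \<le> (1 + \<epsilon>) * pnorm p (A *\<^sub>v xstar - b) powr p"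
    using returns_approx[OF eps run stop] by (simp add: objective_def)
qed

end
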